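(* Under the setting of the Krylov coefficient error bound (i.e. $t>0$, $u_0\neq0$, integers $p,k\ge1$, $m\ge k$, $p$ Arnoldi steps on $L_m$ with starting vector $\mathrm{vec}(u_0,0,\dots,0)$ without breakdown, and $\widetilde c_0(t),\dots,\widetilde c_{k-1}(t)\in\mathbb{C}^n$ the first $k$ blocks of $Q_p\exp(tH_p)e_1\|u_0\|$), define for $\varepsilon\in\mathbb{C}$ $$\mathrm{err}_{K,k,p}(t,\varepsilon):=\Big\|\sum_{\ell=0}^{k-1}\varepsilon^\ell\big(c_\ell(t)-\widetilde c_\ell(t)\big)\Big\|.$$ Then for every $\varepsilon\in\mathbb{C}$ with $|\varepsilon|\neq1$, $$\mathrm{err}_{K,k,p}(t,\varepsilon)\le 2\sqrt{\frac{1-|\varepsilon|^{2k}}{1-|\varepsilon|^2}}\;\frac{(t\alpha)^p\,e^{t\max\{1,\beta\}}}{p!}\,\|u_0\|,$$ with $\alpha=\sum_{\ell=0}^N\|A_\ell\|$ and $\beta=\mu(A_0)+\sum_{\ell=1}^N\|A_\ell\|$.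
   Context: $A_0,\dots,A_N\in\mathbb{C}^{n\times n}$ ($N\ge1$), $u_0\in\mathbb{C}^n$; $\|\cdot\|$ is the Euclidean norm and induced spectral norm. $A(\varepsilon):=\sum_{i=0}^N\varepsilon^iA_i$, and $c_\ell(t)$ are defined by $\exp(tA(\varepsilon))u_0=\sum_{\ell\ge0}\varepsilon^\ell c_\ell(t)$. $L_m\in\mathbb{C}^{mn\times mn}$ is the lower block-triangular block-Toeplitz matrix with $n\times n$ blocks whose $(r,s)$ block equals $A_{r-s}$ if $0\le r-s\le\min(m-1,N)$ and $0$ otherwise. $\mu(B):=\max\Lambda((B+B^* )/2)$ (logarithmic norm). Arnoldi's method ($p$ steps, no breakdown) applied to $B$ with starting vector $v_0$ yields $Q_p$ with orthonormal columns spanning $\mathrm{span}(v_0,\dots,B^{p-1}v_0)$, first column $v_0/\|v_0\|$, and $H_p=Q_p^*BQ_p$; $e_1$ is the first unit vector of $\mathbb{C}^p$. *)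

theory Defs
  imports "HOL-Analysis.Analysis" "Jordan_Normal_Form.Schur_Decomposition"
begin

definition vnorm :: "complex vec \<Rightarrow> real" where
  "vnorm v = sqrt (\<Sum>i<dim_vec v. (cmod (v $ i))^2)"

definition opnorm :: "complex mat \<Rightarrow> real" where
  "opnorm M = Sup {vnorm (M *\<^sub>v x) | x. x \<in> carrier_vec (dim_col M) \<and> vnorm x = 1}"

text \<open>Logarithmic norm: largest eigenvalue of the Hermitian part (B + B^*)/2.
  The eigenvalues of a Hermitian matrix are real; we take the maximum of their real parts.\<close>
definition lognorm :: "complex mat \<Rightarrow> real" where
  "lognorm B = Max (Re ` {k. eigenvalue ((1/2 :: complex) \<cdot>\<^sub>m (B + mat_adjoint B)) k})"

definition mexpv :: "complex \<Rightarrow> complex mat \<Rightarrow> complex vec \<Rightarrow> complex vec" where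
  "mexpv t M v = vec (dim_vec v) (\<lambda>i. \<Sum>j. (t ^ j / of_nat (fact j)) * ((M ^\<^sub>m j) *\<^sub>v v) $ i)"

definition Aeps :: "nat \<Rightarrow> nat \<Rightarrow> (nat \<Rightarrow> complex mat) \<Rightarrow> complex \<Rightarrow> complex mat" where
  "Aeps n N A \<epsilon> = mat n n (\<lambda>(r,s). \<Sum>i\<le>N. \<epsilon>^i * A i $$ (r,s))"

definition coeffs :: "nat \<Rightarrow> nat \<Rightarrow> (nat \<Rightarrow> complex mat) \<Rightarrow> complex vec \<Rightarrow> real \<Rightarrow> nat \<Rightarrow> complex vec" where
  "coeffs n N A u0 t = (THE c. (\<forall>l. c l \<in> carrier_vec n) \<and>
      (\<forall>\<epsilon> i. i < n \<longrightarrow> (\<lambda>l. \<epsilon>^l * c l $ i) sums (mexpv (of_real t) (Aeps n N A \<epsilon>) u0 $ i)))"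

definition Lmat :: "nat \<Rightarrow> nat \<Rightarrow> (nat \<Rightarrow> complex mat) \<Rightarrow> nat \<Rightarrow> complex mat" where
  "Lmat n N A m = mat (m*n) (m*n) (\<lambda>(r,s).
     (let br = r div n; bs = s div n in
      if bs \<le> br \<and> br - bs \<le> min (m-1) N then A (br - bs) $$ (r mod n, s mod n) else 0))"

definition krylov :: "complex mat \<Rightarrow> complex vec \<Rightarrow> nat \<Rightarrow> complex vec set" where
  "krylov B v0 p = {w. \<exists>a. w = vec (dim_vec v0) (\<lambda>i. \<Sum>j<p. a j * ((B ^\<^sub>m j) *\<^sub>v v0) $ i)}"

definition arnoldi_result :: "complex mat \<Rightarrow> complex vec \<Rightarrow> nat \<Rightarrow> complex mat \<Rightarrow> complex mat \<Rightarrow> bool" where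
  "arnoldi_result B v0 p Q H \<longleftrightarrow>
     Q \<in> carrier_mat (dim_vec v0) p \<and>
     mat_adjoint Q * Q = 1\<^sub>m p \<and>
     {Q *\<^sub>v x | x. x \<in> carrier_vec p} = krylov B v0 p \<and>
     col Q 0 = (1 / of_real (vnorm v0)) \<cdot>\<^sub>v v0 \<and>
     H = mat_adjoint Q * B * Q"

end

theory Submission
  imports Defs "Jordan_Normal_Form.Spectral_Radius"
begin

unbundle no vec_syntax

text \<open>The blocks of \<open>exp(t L\<^sub>m) v\<^sub>0\<close>, \<open>v\<^sub>0 = vec(u\<^sub>0, 0, \<dots>, 0)\<close>, are the coefficients \<open>c\<^sub>\<ell>(t)\<close>, so
  by Cauchy--Schwarz it suffices to bound the Arnoldi error for \<open>exp(t L\<^sub>m) v\<^sub>0\<close>. The Arnoldi approximation is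
  exact on polynomials of degree less than \<open>p\<close>, hence the error is the difference of the Taylor
  remainders of order \<open>p\<close> for \<open>L\<^sub>m\<close> and for \<open>H\<^sub>p\<close>. Each remainder \<open>R\<^sub>q\<close> satisfies \<open>R\<^sub>q' = B R\<^sub>q\<^sub>-\<^sub>1\<close>, and
  starting from the logarithmic norm estimate \<open>\<parallel>exp(sB)v\<parallel> \<le> e\<^bsup>s\<mu>(B)\<^esup> \<parallel>v\<parallel>\<close> one integrates \<open>p\<close> times. Both \<open>L\<^sub>m\<close> and
  its compression \<open>H\<^sub>p\<close> have norm at most \<open>\<alpha>\<close> and logarithmic norm at most \<open>\<beta>\<close>.\<close>

section \<open>Euclidean norm and inner product\<close>

text \<open>Linear in the first and conjugate-linear in the second argument. Only the dimension of
  \<open>x\<close> is consulted, so symmetry and Cauchy-Schwarz require equal dimensions.\<close>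

definition ip :: "complex vec \<Rightarrow> complex vec \<Rightarrow> complex" where
  "ip x y = (\<Sum>i<dim_vec x. x $ i * cnj (y $ i))"

text \<open>Bridge to \<open>L2_set\<close>, from which the triangle inequality and Cauchy-Schwarz
  are inherited.\<close>

lemma vnorm_eq_L2_set: "vnorm v = L2_set (\<lambda>i. cmod (v $ i)) {..<dim_vec v}"
  by (simp add: vnorm_def L2_set_def)

lemma vnorm_nonneg [simp]: "0 \<le> vnorm v"
  by (simp add: vnorm_eq_L2_set)

lemma vnorm_squared: "(vnorm v)\<^sup>2 = (\<Sum>i<dim_vec v. (cmod (v $ i))\<^sup>2)"
  by (simp add: vnorm_def sum_nonneg)

lemma ip_self: "ip v v = of_real ((vnorm v)\<^sup>2)"
  by (simp add: ip_def vnorm_squared complex_norm_square del: of_real_power)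

lemma cmod_index_le_vnorm: "i < dim_vec v \<Longrightarrow> cmod (v $ i) \<le> vnorm v"
  by (simp add: vnorm_eq_L2_set member_le_L2_set[where f = "\<lambda>i. cmod (v $ i)"])

lemma vnorm_triangle:
  assumes "x \<in> carrier_vec d" "y \<in> carrier_vec d"
  shows "vnorm (x + y) \<le> vnorm x + vnorm y"
proof -
  have "vnorm (x + y) \<le> L2_set (\<lambda>i. cmod (x $ i) + cmod (y $ i)) {..<d}"
    using assms by (auto simp: vnorm_eq_L2_set intro!: L2_set_mono norm_triangle_ineq)
  also have "\<dots> \<le> vnorm x + vnorm y"
    using assms L2_set_triangle_ineq by (auto simp: vnorm_eq_L2_set)
  finally show ?thesis .
qed

lemma vnorm_smult: "vnorm (c \<cdot>\<^sub>v x) = cmod c * vnorm x"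
  by (simp add: vnorm_eq_L2_set L2_set_right_distrib norm_mult cong: L2_set_cong_simp)

lemma vnorm_zero [simp]: "vnorm (0\<^sub>v d) = 0"
  by (simp add: vnorm_def)

lemma vnorm_eq_0_iff:
  assumes "x \<in> carrier_vec d"
  shows "vnorm x = 0 \<longleftrightarrow> x = 0\<^sub>v d"
proof
  assume "vnorm x = 0"
  then have "x $ i = 0" if "i < d" for i
    using cmod_index_le_vnorm[of i x] that assms by auto
  then show "x = 0\<^sub>v d" using assms by auto
qed simp

lemma vnorm_minus_le:
  assumes "x \<in> carrier_vec d" "y \<in> carrier_vec d"
  shows "vnorm (x - y) \<le> vnorm x + vnorm y"
proof -
  have "x - y = x + (-1) \<cdot>\<^sub>v y" using assms by auto
  then show ?thesis
    using vnorm_triangle[of x d "(-1) \<cdot>\<^sub>v y"] assms by (simp add: vnorm_smult)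
qed

lemma vnorm_sum_le:
  assumes "finite S"
  shows "vnorm (vec d (\<lambda>i. \<Sum>l\<in>S. f l i)) \<le> (\<Sum>l\<in>S. vnorm (vec d (f l)))"
  using assms
proof (induction S)
  case empty
  then show ?case by (simp add: vnorm_def)
next
  case (insert a S)
  have "vec d (\<lambda>i. \<Sum>l\<in>insert a S. f l i) = vec d (f a) + vec d (\<lambda>i. \<Sum>l\<in>S. f l i)"
    using insert by auto
  then show ?case
    using insert vnorm_triangle[of "vec d (f a)" d "vec d (\<lambda>i. \<Sum>l\<in>S. f l i)"] by simp
qed

lemma cmod_ip_le:
  assumes "dim_vec x = dim_vec y"
  shows "cmod (ip x y) \<le> vnorm x * vnorm y"
proof -
  have "cmod (ip x y) \<le> (\<Sum>i<dim_vec x. \<bar>cmod (x $ i)\<bar> * \<bar>cmod (y $ i)\<bar>)"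
    unfolding ip_def by (rule order_trans[OF norm_sum]) (simp add: norm_mult)
  also have "\<dots> \<le> vnorm x * vnorm y"
    using L2_set_mult_ineq[of "\<lambda>i. cmod (x $ i)" "\<lambda>i. cmod (y $ i)" "{..<dim_vec x}"] assms
    by (simp add: vnorm_eq_L2_set)
  finally show ?thesis .
qed

section \<open>Matrices acting on vectors: adjoint, boundedness, induced norm\<close>

lemma mult_mat_vec_index_sum:
  assumes "M \<in> carrier_mat r c" "x \<in> carrier_vec c" "i < r"
  shows "(M *\<^sub>v x) $ i = (\<Sum>j<c. M $$ (i,j) * x $ j)"
  using assms by (auto simp: scalar_prod_def atLeast0LessThan intro!: sum.cong)

lemma mat_adjoint_carrier [simp]:
  "M \<in> carrier_mat r c \<Longrightarrow> mat_adjoint M \<in> carrier_mat c r"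
  by (auto simp: mat_adjoint_def)

lemma mat_adjoint_index:
  assumes "M \<in> carrier_mat r c" "i < c" "j < r"
  shows "mat_adjoint M $$ (i,j) = cnj (M $$ (j,i))"
  using assms by (auto simp: mat_adjoint_def mat_of_rows_index)

lemma ip_adjoint:
  assumes M: "M \<in> carrier_mat r c" and y: "y \<in> carrier_vec r" and x: "x \<in> carrier_vec c"
  shows "ip (mat_adjoint M *\<^sub>v y) x = ip y (M *\<^sub>v x)"
proof -
  have entry: "(mat_adjoint M *\<^sub>v y) $ i = (\<Sum>j<r. cnj (M $$ (j,i)) * y $ j)" if "i < c" for i
    using that by (simp add: mult_mat_vec_index_sum[OF mat_adjoint_carrier[OF M] y] mat_adjoint_index[OF M])
  have "ip (mat_adjoint M *\<^sub>v y) x = (\<Sum>i<c. (\<Sum>j<r. cnj (M $$ (j,i)) * y $ j) * cnj (x $ i))"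
    using entry mat_adjoint_carrier[OF M]
    by (simp add: ip_def del: index_mult_mat_vec) 
  also have "\<dots> = (\<Sum>j<r. y $ j * cnj (\<Sum>i<c. M $$ (j,i) * x $ i))"
    by (simp add: sum_distrib_left sum_distrib_right mult_ac) (rule sum.swap)
  also have "\<dots> = ip y (M *\<^sub>v x)"
    using y by (auto simp: ip_def mult_mat_vec_index_sum[OF M x] simp del: cnj_sum intro!: sum.cong)
  finally show ?thesis .
qed

lemma ip_commute: "dim_vec x = dim_vec y \<Longrightarrow> ip x y = cnj (ip y x)"
  by (simp add: ip_def mult.commute)

lemma ip_add_left:
  assumes "x \<in> carrier_vec d" "y \<in> carrier_vec d"
  shows "ip (x + y) z = ip x z + ip y z"
  using assms by (auto simp: ip_def distrib_right sum.distrib)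

lemma ip_diff_left:
  assumes "x \<in> carrier_vec d" "y \<in> carrier_vec d"
  shows "ip (x - y) z = ip x z - ip y z"
  using assms by (auto simp: ip_def left_diff_distrib sum_subtractf)

lemma ip_smult_left: "ip (c \<cdot>\<^sub>v x) z = c * ip x z"
  by (auto simp: ip_def sum_distrib_left mult_ac)

text \<open>The sum of the moduli of all entries is a crude constant, but only existence matters: it
  makes the supremum in \<open>opnorm\<close> finite and later controls the matrices of the
  eigenvalue argument.\<close>

lemma mult_mat_vec_bounded:
  assumes M: "M \<in> carrier_mat r c"
  obtains C where "C \<ge> 0" "\<And>x. x \<in> carrier_vec c \<Longrightarrow> vnorm (M *\<^sub>v x) \<le> C * vnorm x"
proof
  show "0 \<le> (\<Sum>i<r. \<Sum>j<c. cmod (M $$ (i,j)))" by (simp add: sum_nonneg)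
  fix x :: "complex vec" assume x: "x \<in> carrier_vec c"
  have "vnorm (M *\<^sub>v x) \<le> (\<Sum>i<r. cmod ((M *\<^sub>v x) $ i))"
    using M L2_set_le_sum[of "{..<r}" "\<lambda>i. cmod ((M *\<^sub>v x) $ i)"] by (simp add: vnorm_eq_L2_set)
  also have "\<dots> \<le> (\<Sum>i<r. \<Sum>j<c. cmod (M $$ (i,j)) * vnorm x)"
  proof (rule sum_mono)
    fix i assume "i \<in> {..<r}"
    then have "cmod ((M *\<^sub>v x) $ i) \<le> (\<Sum>j<c. cmod (M $$ (i,j)) * cmod (x $ j))"
      using norm_sum[of "\<lambda>j. M $$ (i,j) * x $ j" "{..<c}"]
      by (simp add: mult_mat_vec_index_sum[OF M x] norm_mult)
    also have "\<dots> \<le> (\<Sum>j<c. cmod (M $$ (i,j)) * vnorm x)"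
      using x by (intro sum_mono mult_left_mono cmod_index_le_vnorm) auto
    finally show "cmod ((M *\<^sub>v x) $ i) \<le> (\<Sum>j<c. cmod (M $$ (i,j)) * vnorm x)" .
  qed
  finally show "vnorm (M *\<^sub>v x) \<le> (\<Sum>i<r. \<Sum>j<c. cmod (M $$ (i,j))) * vnorm x"
    by (simp add: sum_distrib_right)
qed

lemma vnorm_unit_vec: "i < c \<Longrightarrow> vnorm (unit_vec c i) = 1"
  by (simp add: vnorm_def unit_vec_def if_distrib[of cmod] if_distrib[of "\<lambda>x. x^2"] cong: if_cong)

text \<open>Both claims rest on the set under the real \<open>Sup\<close> being bounded above; the
  first then follows by normalizing \<open>x\<close>. Nonnegativity needs a unit vector to exist,
  hence \<open>c > 0\<close>.\<close>

lemma
  assumes M: "M \<in> carrier_mat r c"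
  shows vnorm_mult_mat_vec_le_opnorm: "x \<in> carrier_vec c \<Longrightarrow> vnorm (M *\<^sub>v x) \<le> opnorm M * vnorm x"
    and opnorm_nonneg: "c > 0 \<Longrightarrow> 0 \<le> opnorm M"
proof -
  let ?S = "{vnorm (M *\<^sub>v x) | x. x \<in> carrier_vec (dim_col M) \<and> vnorm x = 1}"
  obtain C where C: "C \<ge> 0" "\<And>x. x \<in> carrier_vec c \<Longrightarrow> vnorm (M *\<^sub>v x) \<le> C * vnorm x"
    using mult_mat_vec_bounded[OF M] by blast
  have bdd: "bdd_above ?S"
    using C(2) M by (intro bdd_aboveI[of _ C]) fastforce
  have unit: "vnorm (M *\<^sub>v y) \<le> opnorm M" if "y \<in> carrier_vec c" "vnorm y = 1" for y
    unfolding opnorm_def using that M by (intro cSup_upper bdd) auto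
  show "vnorm (M *\<^sub>v x) \<le> opnorm M * vnorm x" if x: "x \<in> carrier_vec c" for x
  proof (cases "vnorm x = 0")
    case True
    then show ?thesis using C(2)[OF x] by simp
  next
    case False
    let ?y = "(1 / of_real (vnorm x)) \<cdot>\<^sub>v x"
    have "M *\<^sub>v ?y = (1 / of_real (vnorm x)) \<cdot>\<^sub>v (M *\<^sub>v x)"
      using M x by (rule mult_mat_vec)
    then have "vnorm (M *\<^sub>v x) / vnorm x \<le> opnorm M"
      using unit[of ?y] x False by (simp add: vnorm_smult norm_divide)
    then show ?thesis
      using False by (simp add: field_simps less_le)
  qed
  show "0 \<le> opnorm M" if "c > 0"
    using unit[of "unit_vec c 0"] vnorm_unit_vec[OF that] vnorm_nonneg order_trans
    by (metis unit_vec_carrier)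
qed

section \<open>Remainders of the matrix exponential\<close>

text \<open>\<open>pow_mat\<close> puts the new factor on the right, whereas differentiation and the
  Arnoldi recursion peel one off on the left; the two agree because \<open>M\<close> commutes with
  its powers.\<close>

lemma pow_mat_Suc_mult_vec:
  assumes M: "M \<in> carrier_mat d d" and v: "v \<in> carrier_vec d"
  shows "(M ^\<^sub>m Suc j) *\<^sub>v v = M *\<^sub>v ((M ^\<^sub>m j) *\<^sub>v v)"
proof -
  have pc: "M ^\<^sub>m i \<in> carrier_mat d d" for i using M by simp
  have comm: "M ^\<^sub>m Suc j = M * M ^\<^sub>m j"
  proof (induction j)
    case 0
    then show ?case using M by simp
  next
    case (Suc j)
    have "M ^\<^sub>m Suc (Suc j) = M * M ^\<^sub>m j * M" using Suc by simp
    then show ?case using assoc_mult_mat[OF M pc M] by simp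
  qed
  show ?thesis unfolding comm using assoc_mult_mat_vec[OF M pc v] .
qed

text \<open>The remainder \<open>\<Sum>j\<ge>q. s\<^sup>j/j! M\<^sup>j v\<close> of the exponential series, padded with zero coefficients
  so that every remainder is a power series in \<open>s\<close>.\<close>

definition exp_tail :: "complex mat \<Rightarrow> complex vec \<Rightarrow> nat \<Rightarrow> complex \<Rightarrow> complex vec" where
  "exp_tail M v q s = vec (dim_vec v)
     (\<lambda>i. \<Sum>j. (if j < q then 0 else ((M ^\<^sub>m j) *\<^sub>v v) $ i / fact j) * s ^ j)"

lemma exp_tail_0: "exp_tail M v 0 s = mexpv s M v"
  by (simp add: exp_tail_def mexpv_def mult_ac)

lemma dim_exp_tail [simp]: "dim_vec (exp_tail M v q s) = dim_vec v"
  by (simp add: exp_tail_def)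

text \<open>The constant \<open>\<alpha>\<close> is a parameter rather than \<open>opnorm M\<close>,
  so that the locale can be instantiated with one and the same \<open>\<alpha>\<close> for
  \<open>Lmat\<close> and for its compression \<open>H\<close>.\<close>

locale bounded_mat =
  fixes M :: "complex mat" and d :: nat and \<alpha> :: real
  assumes M: "M \<in> carrier_mat d d"
    and \<alpha>: "0 \<le> \<alpha>"
    and bound: "\<And>x. x \<in> carrier_vec d \<Longrightarrow> vnorm (M *\<^sub>v x) \<le> \<alpha> * vnorm x"
begin

lemma pow_mult_carrier [simp]: "v \<in> carrier_vec d \<Longrightarrow> (M ^\<^sub>m j) *\<^sub>v v \<in> carrier_vec d"
  using M by (metis mult_mat_vec_carrier pow_carrier_mat)

lemma vnorm_pow_mult_le:
  assumes v: "v \<in> carrier_vec d"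
  shows "vnorm ((M ^\<^sub>m j) *\<^sub>v v) \<le> \<alpha> ^ j * vnorm v"
proof (induction j)
  case 0
  then show ?case using M v by simp
next
  case (Suc j)
  have "vnorm ((M ^\<^sub>m Suc j) *\<^sub>v v) \<le> \<alpha> * vnorm ((M ^\<^sub>m j) *\<^sub>v v)"
    using pow_mat_Suc_mult_vec[OF M v] bound v by simp
  also have "\<dots> \<le> \<alpha> * (\<alpha> ^ j * vnorm v)"
    using Suc \<alpha> by (rule mult_left_mono)
  finally show ?case by (simp add: mult_ac)
qed

section \<open>Convergence, derivative and size of the remainders\<close>

lemma summable_exp_tail:
  assumes v: "v \<in> carrier_vec d" and i: "i < d"
  shows "summable (\<lambda>j. (if j < q then 0 else ((M ^\<^sub>m j) *\<^sub>v v) $ i / fact j) * s ^ j)"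
proof (rule summable_comparison_test')
  show "summable (\<lambda>j. vnorm v * (inverse (fact j) * (\<alpha> * cmod s) ^ j))"
    by (intro summable_mult summable_exp)
  fix j
  have "cmod (((M ^\<^sub>m j) *\<^sub>v v) $ i) \<le> \<alpha> ^ j * vnorm v"
    using cmod_index_le_vnorm[of i "(M ^\<^sub>m j) *\<^sub>v v"] vnorm_pow_mult_le[OF v, of j] M i by simp
  then have "cmod (((M ^\<^sub>m j) *\<^sub>v v) $ i) * (cmod s ^ j / fact j)
      \<le> \<alpha> ^ j * vnorm v * (cmod s ^ j / fact j)"
    by (rule mult_right_mono) simp
  then show "norm ((if j < q then 0 else ((M ^\<^sub>m j) *\<^sub>v v) $ i / fact j) * s ^ j)
      \<le> vnorm v * (inverse (fact j) * (\<alpha> * cmod s) ^ j)"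
    using \<alpha> by (simp add: norm_mult norm_divide norm_power power_mult_distrib field_simps)
qed

lemma mexpv_split:
  assumes v: "v \<in> carrier_vec d" and i: "i < d"
  shows "mexpv s M v $ i = (\<Sum>j<q. s ^ j / fact j * ((M ^\<^sub>m j) *\<^sub>v v) $ i) + exp_tail M v q s $ i"
proof -
  let ?f = "\<lambda>q j. (if j < q then 0 else ((M ^\<^sub>m j) *\<^sub>v v) $ i / fact j) * s ^ j"
  let ?g = "\<lambda>j. if j < q then s ^ j / fact j * ((M ^\<^sub>m j) *\<^sub>v v) $ i else 0"
  have g: "?g sums (\<Sum>j<q. s ^ j / fact j * ((M ^\<^sub>m j) *\<^sub>v v) $ i)"
    using sums_If_finite[of "\<lambda>j. j < q" "\<lambda>j. s ^ j / fact j * ((M ^\<^sub>m j) *\<^sub>v v) $ i"]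
    by (simp add: lessThan_def)
  have "(\<lambda>j. ?g j + ?f q j) sums
      ((\<Sum>j<q. s ^ j / fact j * ((M ^\<^sub>m j) *\<^sub>v v) $ i) + suminf (?f q))"
    by (rule sums_add[OF g summable_sums[OF summable_exp_tail[OF v i]]])
  moreover have "(\<lambda>j. ?g j + ?f q j) = ?f 0"
    by (auto simp: fun_eq_iff)
  ultimately show ?thesis
    using v i by (simp add: exp_tail_0[symmetric] exp_tail_def sums_iff)
qed

text \<open>Termwise differentiation: \<open>diffs\<close> moves the coefficients down by one index
  and so frees one factor \<open>M\<close>. With truncated subtraction the case \<open>q = 0\<close>
  is the equation y' = My of the full exponential.\<close>

lemma exp_tail_has_field_derivative:
  assumes v: "v \<in> carrier_vec d" and i: "i < d"
  shows "((\<lambda>s. exp_tail M v q s $ i) has_field_derivative (M *\<^sub>v exp_tail M v (q - 1) s) $ i) (at s)"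
proof -
  let ?c = "\<lambda>q i j. (if j < q then 0 else ((M ^\<^sub>m j) *\<^sub>v v) $ i / fact j)"
  have "((\<lambda>s. \<Sum>j. ?c q i j * s ^ j) has_field_derivative (\<Sum>j. diffs (?c q i) j * s ^ j)) (at s)"
    by (rule termdiffs_strong_converges_everywhere) (rule summable_exp_tail[OF v i])
  moreover have "(\<Sum>j. diffs (?c q i) j * s ^ j) = (M *\<^sub>v exp_tail M v (q - 1) s) $ i"
  proof -
    have "diffs (?c q i) j = (\<Sum>k<d. M $$ (i,k) * ?c (q - 1) k j)" for j
    proof -
      have "diffs (?c q i) j = (if j < q - 1 then 0 else ((M ^\<^sub>m Suc j) *\<^sub>v v) $ i / fact j)"
        by (auto simp: diffs_def simp del: pow_mat.simps of_nat_Suc)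
      also have "\<dots> = (\<Sum>k<d. M $$ (i,k) * ?c (q - 1) k j)"
        unfolding pow_mat_Suc_mult_vec[OF M v]
          mult_mat_vec_index_sum[OF M pow_mult_carrier[OF v] i]
        by (simp add: sum_divide_distrib)
      finally show ?thesis .
    qed
    then have "(\<Sum>j. diffs (?c q i) j * s ^ j) = (\<Sum>j. \<Sum>k<d. M $$ (i,k) * (?c (q - 1) k j * s ^ j))"
      by (simp add: sum_distrib_right mult.assoc)
    also have "\<dots> = (\<Sum>k<d. \<Sum>j. M $$ (i,k) * (?c (q - 1) k j * s ^ j))"
      by (rule suminf_sum) (auto intro!: summable_mult summable_exp_tail[OF v])
    also have "\<dots> = (\<Sum>k<d. M $$ (i,k) * (\<Sum>j. ?c (q - 1) k j * s ^ j))"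
      by (intro sum.cong refl suminf_mult summable_exp_tail[OF v]) auto
    also have "\<dots> = (M *\<^sub>v exp_tail M v (q - 1) s) $ i"
      using v i by (subst mult_mat_vec_index_sum[OF M]) (auto simp: exp_tail_def intro!: sum.cong)
    finally show ?thesis .
  qed
  ultimately show ?thesis using v i by (simp add: exp_tail_def)
qed

lemma exp_tail_has_vector_derivative:
  assumes v: "v \<in> carrier_vec d" and i: "i < d"
  shows "((\<lambda>s. exp_tail M v q (of_real s) $ i) has_vector_derivative
    (M *\<^sub>v exp_tail M v (q - 1) (of_real s)) $ i) (at s)"
  using has_vector_derivative_real_field[OF exp_tail_has_field_derivative[OF v i]] .

text \<open>A Gronwall argument: for y(s) = exp(sM)v the derivative of |y|^2 is 2 Re <My, y>, which
  is at most 2b|y|^2, so exp(-2bs)|y|^2 is nonincreasing. The sign of \<open>b\<close> is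
  arbitrary.\<close>

lemma vnorm_mexpv_le:
  assumes v: "v \<in> carrier_vec d" and s: "0 \<le> s"
    and lognorm_bound: "\<And>x. x \<in> carrier_vec d \<Longrightarrow> Re (ip (M *\<^sub>v x) x) \<le> b * (vnorm x)\<^sup>2"
  shows "vnorm (mexpv (of_real s) M v) \<le> exp (b * s) * vnorm v"
proof -
  define y where "y s = exp_tail M v 0 (of_real s)" for s :: real
  have y [simp]: "y s \<in> carrier_vec d" for s
    using v by (auto simp: y_def intro!: carrier_vecI)
  have "((\<lambda>s. y s $ i) has_vector_derivative (M *\<^sub>v y s) $ i) (at s)" if "i < d" for s i
    using exp_tail_has_vector_derivative[OF v that, of 0 s] by (simp add: y_def)
  \<comment> \<open>Real and imaginary parts are differentiated separately, so that the squared norm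
    becomes a sum of squares of real functions; squaring avoids the kink of the norm at
    zero.\<close>
  then have D: "((\<lambda>s. Re (y s $ i)) has_field_derivative Re ((M *\<^sub>v y s) $ i)) (at s)"
    "((\<lambda>s. Im (y s $ i)) has_field_derivative Im ((M *\<^sub>v y s) $ i)) (at s)" if "i < d" for s i
    using that by (auto simp: has_vector_derivative_complex_iff)
  have norm_y: "(vnorm (y s))\<^sup>2 = (\<Sum>i<d. (Re (y s $ i))\<^sup>2 + (Im (y s $ i))\<^sup>2)" for s
    using v by (simp add: vnorm_squared cmod_power2 y_def)
  have D2: "((\<lambda>s. (vnorm (y s))\<^sup>2) has_field_derivative 2 * Re (ip (M *\<^sub>v y s) (y s))) (at s)" for s
  proof -
    have "((\<lambda>s. (Re (y s $ i))\<^sup>2 + (Im (y s $ i))\<^sup>2) has_field_derivative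
        2 * Re ((M *\<^sub>v y s) $ i * cnj (y s $ i))) (at s)" if "i < d" for i
      by (rule DERIV_cong[OF DERIV_add[OF DERIV_power[OF D(1)[OF that]] DERIV_power[OF D(2)[OF that]]]])
        (simp add: algebra_simps)
    then have "((\<lambda>s. \<Sum>i<d. (Re (y s $ i))\<^sup>2 + (Im (y s $ i))\<^sup>2) has_field_derivative
        (\<Sum>i<d. 2 * Re ((M *\<^sub>v y s) $ i * cnj (y s $ i)))) (at s)"
      by (intro DERIV_sum) auto
    moreover have "(\<Sum>i<d. 2 * Re ((M *\<^sub>v y s) $ i * cnj (y s $ i))) = 2 * Re (ip (M *\<^sub>v y s) (y s))"
      using M by (simp only: ip_def Re_sum sum_distrib_left dim_mult_mat_vec carrier_matD)
    ultimately show ?thesis unfolding norm_y by (simp only:)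
  qed
  have "exp (- 2 * b * s) * (vnorm (y s))\<^sup>2 \<le> exp (- 2 * b * 0) * (vnorm (y 0))\<^sup>2"
  proof (rule DERIV_nonpos_imp_nonincreasing[OF s])
    fix x :: real
    have "((\<lambda>s. exp (- 2 * b * s) * (vnorm (y s))\<^sup>2) has_field_derivative
        2 * exp (- 2 * b * x) * (Re (ip (M *\<^sub>v y x) (y x)) - b * (vnorm (y x))\<^sup>2)) (at x)"
      by (rule derivative_eq_intros D2 refl | simp)+ (simp add: algebra_simps)
    moreover have "2 * exp (- 2 * b * x) * (Re (ip (M *\<^sub>v y x) (y x)) - b * (vnorm (y x))\<^sup>2) \<le> 0"
      using lognorm_bound[OF y[of x]] by (intro mult_nonneg_nonpos) auto
    ultimately show "\<exists>z. ((\<lambda>s. exp (- 2 * b * s) * (vnorm (y s))\<^sup>2) has_field_derivative z) (at x) \<and> z \<le> 0"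
      by blast
  qed
  moreover have "y 0 = v"
  proof (rule eq_vecI)
    fix i assume "i < dim_vec v"
    then show "y 0 $ i = v $ i"
      using powser_zero[of "\<lambda>j. if j < 0 then 0 else ((M ^\<^sub>m j) *\<^sub>v v) $ i / fact j"] v M
      by (simp add: y_def exp_tail_def)
  qed (use v in \<open>simp add: y_def\<close>)
  ultimately have "(vnorm (y s))\<^sup>2 \<le> (exp (b * s) * vnorm v)\<^sup>2"
    by (simp add: exp_minus power_mult_distrib field_simps flip: exp_double)
  then show ?thesis
    by (simp add: y_def exp_tail_0 power2_le_iff_abs_le)
qed

text \<open>Induction on \<open>q\<close>: the remainder of order \<open>q + 1\<close> vanishes at 0
  and has derivative M times the remainder of order \<open>q\<close>, so integration contributes the
  factor s\<alpha>/(q+1). Since \<open>b\<close> is nonnegative, exp(bs) may be replaced by exp(tb),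
  which stays constant under the integration.\<close>

lemma vnorm_exp_tail_le:
  assumes v: "v \<in> carrier_vec d" and b: "0 \<le> b"
    and lognorm_bound: "\<And>x. x \<in> carrier_vec d \<Longrightarrow> Re (ip (M *\<^sub>v x) x) \<le> b * (vnorm x)\<^sup>2"
    and s: "0 \<le> s" "s \<le> t"
  shows "vnorm (exp_tail M v q (of_real s)) \<le> (s * \<alpha>) ^ q / fact q * (exp (t * b) * vnorm v)"
  using s
proof (induction q arbitrary: s)
  case 0
  have "exp (b * s) * vnorm v \<le> exp (t * b) * vnorm v"
    using 0 b by (intro mult_right_mono) (auto simp: mult.commute mult_left_mono)
  then show ?case
    using vnorm_mexpv_le[OF v _ lognorm_bound, of s] 0 by (simp add: exp_tail_0)
next
  case (Suc q)
  let ?y = "\<lambda>q s. exp_tail M v q (complex_of_real s)"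
  define K where "K = exp (t * b) * vnorm v"
  define w where "w = ?y (Suc q) s"
  have y [simp]: "?y q s \<in> carrier_vec d" for q s
    using v by (auto intro!: carrier_vecI)
  have y0: "?y (Suc q) 0 = 0\<^sub>v d"
    using v by (auto simp: exp_tail_def)
  show ?case
  proof (cases "s = 0 \<or> vnorm w = 0")
    case True
    then show ?thesis
      using y0 \<alpha> Suc.prems by (auto simp: w_def)
  next
    case False
    then have "0 < s" "0 < vnorm w" using Suc.prems by (auto simp: less_le)
    \<comment> \<open>Pairing with the fixed end value \<open>w\<close> makes the problem scalar. At
      the right end point the pairing equals |w|^2, so one factor |w| cancels in the end.\<close>
    have D: "((\<lambda>s. ip (?y (Suc q) s) w) has_vector_derivative ip (M *\<^sub>v ?y q x) w) (at x)" for x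
      using exp_tail_has_vector_derivative[OF v, of _ "Suc q" x] v M
      unfolding ip_def by (auto intro!: derivative_eq_intros has_vector_derivative_sum)
    \<comment> \<open>An explicit antiderivative of the majorant supplied by the induction
      hypothesis; the mean value inequality then replaces an integral.\<close>
    define \<phi> where "\<phi> x = \<alpha> ^ Suc q * x ^ Suc q / fact (Suc q) * K * vnorm w" for x
    have D\<phi>: "(\<phi> has_vector_derivative \<alpha> * ((x * \<alpha>) ^ q / fact q * K) * vnorm w) (at x)" for x
      unfolding \<phi>_def has_real_derivative_iff_has_vector_derivative[symmetric]
      by (rule derivative_eq_intros refl | simp)+ (simp add: field_simps power_mult_distrib)
    have "norm (ip (?y (Suc q) s) w - ip (?y (Suc q) 0) w) \<le> \<phi> s - \<phi> 0"
    proof (rule differentiable_bound_general[OF \<open>0 < s\<close> _ _ D D\<phi>])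
      show "continuous_on {0..s} (\<lambda>s. ip (?y (Suc q) s) w)"
        by (rule continuous_at_imp_continuous_on) (use D has_vector_derivative_continuous in blast)
      show "continuous_on {0..s} \<phi>"
        by (rule continuous_at_imp_continuous_on) (use D\<phi> has_vector_derivative_continuous in blast)
      fix x assume x: "0 < x" "x < s"
      have "norm (ip (M *\<^sub>v ?y q x) w) \<le> vnorm (M *\<^sub>v ?y q x) * vnorm w"
        using M v by (intro cmod_ip_le) (simp add: w_def)
      also have "\<dots> \<le> \<alpha> * ((x * \<alpha>) ^ q / fact q * K) * vnorm w"
        using Suc.IH[of x] x Suc.prems \<alpha>
        by (intro mult_right_mono order_trans[OF bound] mult_left_mono) (auto simp: K_def)
      finally show "norm (ip (M *\<^sub>v ?y q x) w) \<le> \<alpha> * ((x * \<alpha>) ^ q / fact q * K) * vnorm w" .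
    qed
    moreover have "norm (ip (?y (Suc q) s) w - ip (?y (Suc q) 0) w) = vnorm w * vnorm w"
      using y0 by (simp add: ip_self flip: w_def) (simp add: ip_def norm_mult power2_eq_square)
    ultimately have "vnorm w * vnorm w \<le> ((s * \<alpha>) ^ Suc q / fact (Suc q) * K) * vnorm w"
      by (simp add: \<phi>_def power_mult_distrib mult_ac)
    then show ?thesis
      using \<open>0 < vnorm w\<close> unfolding K_def w_def by (rule mult_right_le_imp_le)
  qed
qed

end

section \<open>Error of the Arnoldi approximation\<close>

lemma vnorm_isometry:
  assumes Q: "Q \<in> carrier_mat d p" and QQ: "mat_adjoint Q * Q = 1\<^sub>m p" and x: "x \<in> carrier_vec p"
  shows "vnorm (Q *\<^sub>v x) = vnorm x"
proof -
  have Qx: "Q *\<^sub>v x \<in> carrier_vec d" using Q x by simp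
  have "mat_adjoint Q *\<^sub>v (Q *\<^sub>v x) = x"
    using assoc_mult_mat_vec[OF mat_adjoint_carrier[OF Q] Q x] QQ x by simp
  then have "ip (Q *\<^sub>v x) (Q *\<^sub>v x) = ip x x"
    using ip_adjoint[OF Q Qx x] by simp
  then have "(vnorm (Q *\<^sub>v x))\<^sup>2 = (vnorm x)\<^sup>2"
    unfolding ip_self of_real_eq_iff .
  then show ?thesis by simp
qed

text \<open>|Q*y|^2 = <y, QQ*y> is at most |y| |Q*y| because \<open>Q\<close> preserves norms; then
  one factor cancels.\<close>

lemma vnorm_adjoint_isometry_le:
  assumes Q: "Q \<in> carrier_mat d p" and QQ: "mat_adjoint Q * Q = 1\<^sub>m p" and y: "y \<in> carrier_vec d"
  shows "vnorm (mat_adjoint Q *\<^sub>v y) \<le> vnorm y"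
proof -
  let ?z = "mat_adjoint Q *\<^sub>v y"
  have z: "?z \<in> carrier_vec p" using mat_adjoint_carrier[OF Q] y by simp
  have "(vnorm ?z)\<^sup>2 = cmod (ip ?z ?z)" by (simp add: ip_self norm_power)
  also have "\<dots> = cmod (ip y (Q *\<^sub>v ?z))" by (simp add: ip_adjoint[OF Q y z])
  also have "\<dots> \<le> vnorm y * vnorm ?z"
    using cmod_ip_le[of y "Q *\<^sub>v ?z"] vnorm_isometry[OF Q QQ z] Q y by simp
  finally show ?thesis
    by (cases "vnorm ?z = 0") (auto simp: power2_eq_square less_le)
qed

text \<open>As long as the exponent stays below \<open>p\<close>, the vector B^(j+1) v0 lies in the
  Krylov space, which is the range of \<open>Q\<close>. There QQ* acts as the identity, so inserting
  it in front of \<open>B\<close> turns \<open>B\<close> into \<open>H\<close>.\<close>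

lemma arnoldi_power:
  assumes B: "B \<in> carrier_mat d d" and v0: "v0 \<in> carrier_vec d" "v0 \<noteq> 0\<^sub>v d" and p: "p \<ge> 1"
    and ar: "arnoldi_result B v0 p Q H" and j: "j < p"
  shows "(B ^\<^sub>m j) *\<^sub>v v0 = of_real (vnorm v0) \<cdot>\<^sub>v (Q *\<^sub>v ((H ^\<^sub>m j) *\<^sub>v unit_vec p 0))"
  using j
proof (induction j)
  have Q: "Q \<in> carrier_mat d p" and H: "H = mat_adjoint Q * B * Q"
    and QQ: "mat_adjoint Q * Q = 1\<^sub>m p"
    and K: "{Q *\<^sub>v x | x. x \<in> carrier_vec p} = krylov B v0 p"
    and col0: "col Q 0 = (1 / of_real (vnorm v0)) \<cdot>\<^sub>v v0"
    using ar v0 by (auto simp: arnoldi_result_def)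
  note Qa = mat_adjoint_carrier[OF Q]
  have Hc: "H \<in> carrier_mat p p" unfolding H by (rule mult_carrier_mat[OF mult_carrier_mat[OF Qa B] Q])
  have e: "unit_vec p 0 \<in> carrier_vec p" by simp
  have Hx: "H *\<^sub>v x = mat_adjoint Q *\<^sub>v (B *\<^sub>v (Q *\<^sub>v x))" if "x \<in> carrier_vec p" for x
    unfolding H assoc_mult_mat_vec[OF mult_carrier_mat[OF Qa B] Q that]
    using that by (intro assoc_mult_mat_vec[OF Qa B] mult_mat_vec_carrier[OF Q])
  {
    case 0
    have "Q *\<^sub>v unit_vec p 0 = col Q 0"
      using Q p by (intro eq_vecI) auto
    then show ?case
      using col0 Hc B v0 vnorm_eq_0_iff[of v0 d] by (simp add: smult_smult_assoc)
  next
    case (Suc j)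
    let ?h = "(H ^\<^sub>m j) *\<^sub>v unit_vec p 0"
    have hc: "?h \<in> carrier_vec p" using Hc e by (metis mult_mat_vec_carrier pow_carrier_mat)
    define w where "w = (B ^\<^sub>m Suc j) *\<^sub>v v0"
    have w: "w \<in> carrier_vec d"
      unfolding w_def using B v0 by (metis mult_mat_vec_carrier pow_carrier_mat)
    \<comment> \<open>Membership in the Krylov space is witnessed by the indicator sequence of
      \<open>Suc j\<close>, an admissible index because \<open>Suc j < p\<close>.\<close>
    have "w = vec (dim_vec v0) (\<lambda>i. \<Sum>k<p. (if k = Suc j then 1 else 0) * ((B ^\<^sub>m k) *\<^sub>v v0) $ i)"
      using Suc.prems w v0 B by (intro eq_vecI) (auto simp: w_def if_distrib[of "\<lambda>x. x * _"] simp del: pow_mat.simps index_mult_mat_vec cong: if_cong)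
    then have "w \<in> krylov B v0 p"
      unfolding krylov_def by (intro CollectI exI[of _ "\<lambda>k. if k = Suc j then 1 else 0"])
    then obtain x where x: "x \<in> carrier_vec p" "w = Q *\<^sub>v x" using K by blast
    have "mat_adjoint Q *\<^sub>v w = x"
      using assoc_mult_mat_vec[OF Qa Q x(1)] QQ x by simp
    moreover have "w = of_real (vnorm v0) \<cdot>\<^sub>v (B *\<^sub>v (Q *\<^sub>v ?h))"
      using Suc pow_mat_Suc_mult_vec[OF B v0(1)] mult_mat_vec[OF B, of "Q *\<^sub>v ?h"] Q hc
      by (simp add: w_def del: pow_mat.simps)
    ultimately have "x = of_real (vnorm v0) \<cdot>\<^sub>v (mat_adjoint Q *\<^sub>v (B *\<^sub>v (Q *\<^sub>v ?h)))"
      using mult_mat_vec[OF Qa, of "B *\<^sub>v (Q *\<^sub>v ?h)"] B Q hc by simp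
    also have "mat_adjoint Q *\<^sub>v (B *\<^sub>v (Q *\<^sub>v ?h)) = H *\<^sub>v ?h"
      by (rule Hx[OF hc, symmetric])
    also have "\<dots> = (H ^\<^sub>m Suc j) *\<^sub>v unit_vec p 0"
      using pow_mat_Suc_mult_vec[OF Hc e] by simp
    finally have "w = of_real (vnorm v0) \<cdot>\<^sub>v (Q *\<^sub>v ((H ^\<^sub>m Suc j) *\<^sub>v unit_vec p 0))"
      using x(2) mult_mat_vec[OF Q] Hc e by (metis mult_mat_vec_carrier pow_carrier_mat)
    then show ?case by (simp only: w_def)
  }
qed

text \<open>Splitting both exponentials at order \<open>p\<close>, the Taylor polynomials cancel by
  \<open>arnoldi_power\<close>. Two tails obeying the same estimate remain, whence the factor
  2.\<close>

theorem arnoldi_exp_error: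
  assumes "bounded_mat B d \<alpha>" and v0: "v0 \<in> carrier_vec d" "v0 \<noteq> 0\<^sub>v d" and p: "p \<ge> 1"
    and b: "0 \<le> b"
    and lognorm_bound: "\<And>x. x \<in> carrier_vec d \<Longrightarrow> Re (ip (B *\<^sub>v x) x) \<le> b * (vnorm x)\<^sup>2"
    and ar: "arnoldi_result B v0 p Q H" and t: "0 \<le> t"
  shows "vnorm (mexpv (of_real t) B v0 -
      of_real (vnorm v0) \<cdot>\<^sub>v (Q *\<^sub>v mexpv (of_real t) H (unit_vec p 0)))
    \<le> 2 * ((t * \<alpha>) ^ p / fact p * (exp (t * b) * vnorm v0))"
proof -
  interpret B: bounded_mat B d \<alpha> by fact
  have Q: "Q \<in> carrier_mat d p" and H: "H = mat_adjoint Q * B * Q"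
    and QQ: "mat_adjoint Q * Q = 1\<^sub>m p"
    using ar v0 by (auto simp: arnoldi_result_def)
  note Qa = mat_adjoint_carrier[OF Q]
  have Hc: "H \<in> carrier_mat p p" unfolding H by (rule mult_carrier_mat[OF mult_carrier_mat[OF Qa B.M] Q])
  let ?e = "unit_vec p 0 :: complex vec"
  have e: "?e \<in> carrier_vec p" by simp
  have Hx: "H *\<^sub>v x = mat_adjoint Q *\<^sub>v (B *\<^sub>v (Q *\<^sub>v x))" if "x \<in> carrier_vec p" for x
    unfolding H assoc_mult_mat_vec[OF mult_carrier_mat[OF Qa B.M] Q that]
    using that by (intro assoc_mult_mat_vec[OF Qa B.M] mult_mat_vec_carrier[OF Q])
  have BQ: "B *\<^sub>v (Q *\<^sub>v x) \<in> carrier_vec d" if "x \<in> carrier_vec p" for x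
    using B.M Q that by simp
  interpret H: bounded_mat H p \<alpha>
  proof
    fix x :: "complex vec" assume x: "x \<in> carrier_vec p"
    have "vnorm (H *\<^sub>v x) \<le> vnorm (B *\<^sub>v (Q *\<^sub>v x))"
      using vnorm_adjoint_isometry_le[OF Q QQ BQ[OF x]] Hx[OF x] by simp
    also have "\<dots> \<le> \<alpha> * vnorm x"
      using B.bound[of "Q *\<^sub>v x"] vnorm_isometry[OF Q QQ x] Q x by simp
    finally show "vnorm (H *\<^sub>v x) \<le> \<alpha> * vnorm x" .
  qed (use Hc B.\<alpha> in auto)
  \<comment> \<open>The quadratic form of the compression is that of \<open>B\<close> on the range
    of \<open>Q\<close>: <Hx, x> = <BQx, Qx> with |Qx| = |x|.\<close>
  have lognorm_H: "Re (ip (H *\<^sub>v x) x) \<le> b * (vnorm x)\<^sup>2" if x: "x \<in> carrier_vec p" for x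
    using lognorm_bound[of "Q *\<^sub>v x"] ip_adjoint[OF Q BQ[OF x] x] Hx[OF x]
      vnorm_isometry[OF Q QQ x] Q x by simp
  let ?c = "complex_of_real (vnorm v0)" and ?t = "complex_of_real t"
  have "mexpv ?t B v0 - ?c \<cdot>\<^sub>v (Q *\<^sub>v mexpv ?t H ?e) = exp_tail B v0 p ?t - ?c \<cdot>\<^sub>v (Q *\<^sub>v exp_tail H ?e p ?t)"
    (is "?l = ?r")
  proof (rule eq_vecI)
    show "dim_vec ?l = dim_vec ?r" using Q by simp
    fix i assume "i < dim_vec ?r"
    then have i: "i < d" using Q by simp
    have mc: "mexpv ?t H ?e \<in> carrier_vec p" "exp_tail H ?e p ?t \<in> carrier_vec p"
      by (auto simp: mexpv_def exp_tail_def)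
    have "?c * (Q *\<^sub>v mexpv ?t H ?e) $ i =
      ?c * (\<Sum>k<p. Q $$ (i,k) * (\<Sum>j<p. ?t ^ j / fact j * ((H ^\<^sub>m j) *\<^sub>v ?e) $ k))
      + ?c * (Q *\<^sub>v exp_tail H ?e p ?t) $ i"
      unfolding mult_mat_vec_index_sum[OF Q mc(1) i] mult_mat_vec_index_sum[OF Q mc(2) i]
      by (simp add: H.mexpv_split[OF e, of _ _ p] distrib_left sum.distrib del: index_mult_mat_vec)
    also have "?c * (\<Sum>k<p. Q $$ (i,k) * (\<Sum>j<p. ?t ^ j / fact j * ((H ^\<^sub>m j) *\<^sub>v ?e) $ k))
      = (\<Sum>j<p. ?t ^ j / fact j * (?c * (\<Sum>k<p. Q $$ (i,k) * ((H ^\<^sub>m j) *\<^sub>v ?e) $ k)))"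
      unfolding sum_distrib_left by (subst sum.swap) (simp add: mult_ac)
    also have "\<dots> = (\<Sum>j<p. ?t ^ j / fact j * ((B ^\<^sub>m j) *\<^sub>v v0) $ i)"
    proof (rule sum.cong[OF refl])
      fix j assume "j \<in> {..<p}"
      then have "((B ^\<^sub>m j) *\<^sub>v v0) $ i = ?c * (Q *\<^sub>v ((H ^\<^sub>m j) *\<^sub>v ?e)) $ i"
        using arnoldi_power[OF B.M v0 p ar, of j] Q i by simp
      also have "(Q *\<^sub>v ((H ^\<^sub>m j) *\<^sub>v ?e)) $ i = (\<Sum>k<p. Q $$ (i,k) * ((H ^\<^sub>m j) *\<^sub>v ?e) $ k)"
        using H.pow_mult_carrier[OF e] Q i by (intro mult_mat_vec_index_sum) auto
      finally show "?t ^ j / fact j * (?c * (\<Sum>k<p. Q $$ (i,k) * ((H ^\<^sub>m j) *\<^sub>v ?e) $ k))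
        = ?t ^ j / fact j * ((B ^\<^sub>m j) *\<^sub>v v0) $ i" by simp
    qed
    finally have "mexpv ?t B v0 $ i - ?c * (Q *\<^sub>v mexpv ?t H ?e) $ i =
        exp_tail B v0 p ?t $ i - ?c * (Q *\<^sub>v exp_tail H ?e p ?t) $ i"
      using B.mexpv_split[OF v0(1) i, of ?t p] by simp
    then show "?l $ i = ?r $ i" using Q i by (simp del: index_mult_mat_vec)
  qed
  then have "vnorm ?l = vnorm ?r" by simp
  also have "\<dots> \<le> vnorm (exp_tail B v0 p ?t) + vnorm (?c \<cdot>\<^sub>v (Q *\<^sub>v exp_tail H ?e p ?t))"
    using Q v0 by (intro vnorm_minus_le[of _ d]) (auto intro!: carrier_vecI)
  also have "vnorm (?c \<cdot>\<^sub>v (Q *\<^sub>v exp_tail H ?e p ?t)) = vnorm v0 * vnorm (exp_tail H ?e p ?t)"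
    using vnorm_isometry[OF Q QQ, of "exp_tail H ?e p ?t"]
    by (simp add: vnorm_smult carrier_vecI)
  also have "\<dots> \<le> vnorm v0 * ((t * \<alpha>) ^ p / fact p * (exp (t * b) * vnorm ?e))"
    by (intro mult_left_mono H.vnorm_exp_tail_le[OF e b lognorm_H t]) auto
  also have "vnorm ?e = 1" using p by (simp add: vnorm_unit_vec)
  also have "vnorm v0 * ((t * \<alpha>) ^ p / fact p * (exp (t * b) * 1)) = (t * \<alpha>) ^ p / fact p * (exp (t * b) * vnorm v0)"
    by simp
  finally show ?thesis
    using B.vnorm_exp_tail_le[OF v0(1) b lognorm_bound t order.refl, of p] by linarith
qed

section \<open>Logarithmic norm\<close>

text \<open>With \<open>\<mu>\<close> the supremum of the Rayleigh quotient and \<open>G = S - \<mu>\<close>, semidefiniteness of \<open>-G\<close> gives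
  \<open>\<parallel>G x\<parallel>\<^sup>2 \<le> -D \<langle>G x, x\<rangle>\<close>. If \<open>\<mu>\<close> were no eigenvalue, \<open>G\<close> would be invertible, which would keep
  \<open>-\<langle>G x, x\<rangle>\<close> away from \<open>0\<close> on the unit sphere. No compactness is needed.\<close>

lemma hermitian_rayleigh_le_max_eigenvalue:
  assumes S: "S \<in> carrier_mat n n" and n: "n > 0"
    and herm: "\<And>x y. x \<in> carrier_vec n \<Longrightarrow> y \<in> carrier_vec n \<Longrightarrow> ip (S *\<^sub>v x) y = ip x (S *\<^sub>v y)"
    and x: "x \<in> carrier_vec n"
  shows "Re (ip (S *\<^sub>v x) x) \<le> Max (Re ` {k. eigenvalue S k}) * (vnorm x)\<^sup>2"
proof -
  let ?R = "{Re (ip (S *\<^sub>v x) x) | x. x \<in> carrier_vec n \<and> vnorm x = 1}"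
  define \<mu> where "\<mu> = Sup ?R"
  obtain C where C: "C \<ge> 0" "\<And>x. x \<in> carrier_vec n \<Longrightarrow> vnorm (S *\<^sub>v x) \<le> C * vnorm x"
    using mult_mat_vec_bounded[OF S] by blast
  have bdd: "bdd_above ?R"
  proof (rule bdd_aboveI)
    fix r assume "r \<in> ?R"
    then obtain x where x: "x \<in> carrier_vec n" "vnorm x = 1" "r = Re (ip (S *\<^sub>v x) x)" by blast
    then have "r \<le> vnorm (S *\<^sub>v x) * vnorm x"
      using cmod_ip_le[of "S *\<^sub>v x" x] complex_Re_le_cmod[of "ip (S *\<^sub>v x) x"] S by simp
    then show "r \<le> C" using C(2)[OF x(1)] x(2) by simp
  qed
  have ne: "?R \<noteq> {}" using vnorm_unit_vec[OF n] by (auto intro!: exI[of _ "unit_vec n 0"])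
  have le: "Re (ip (S *\<^sub>v x) x) \<le> \<mu> * (vnorm x)\<^sup>2" if x: "x \<in> carrier_vec n" for x
  proof (cases "vnorm x = 0")
    case True
    then show ?thesis using cmod_ip_le[of "S *\<^sub>v x" x] S x by simp
  next
    case False
    let ?c = "1 / complex_of_real (vnorm x)"
    let ?y = "?c \<cdot>\<^sub>v x"
    have "Re (ip (S *\<^sub>v ?y) ?y) \<le> \<mu>"
      unfolding \<mu>_def using x False by (intro cSup_upper bdd) (auto simp: vnorm_smult norm_divide)
    also have "ip (S *\<^sub>v ?y) ?y = ip (S *\<^sub>v x) x / of_real ((vnorm x)\<^sup>2)"
      using mult_mat_vec[OF S x] x S ip_commute[of "S *\<^sub>v x" ?y] ip_commute[of "S *\<^sub>v x" x]
      by (simp add: ip_smult_left power2_eq_square)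
    finally show ?thesis using False by (simp add: field_simps less_le)
  qed
  define G where "G = char_matrix S (of_real \<mu>)"
  have G: "G \<in> carrier_mat n n" using S by (simp add: G_def)
  have Gx: "G *\<^sub>v x = S *\<^sub>v x - of_real \<mu> \<cdot>\<^sub>v x" if "x \<in> carrier_vec n" for x
    using S that
    by (intro eq_vecI) (auto simp: G_def char_matrix_def add_mult_distrib_mat_vec[of _ n n])
  have Gherm: "ip (G *\<^sub>v x) y = ip x (G *\<^sub>v y)" if "x \<in> carrier_vec n" "y \<in> carrier_vec n" for x y
    using that S herm[OF that] ip_diff_left[of "S *\<^sub>v x" n "of_real \<mu> \<cdot>\<^sub>v x" y]
      ip_diff_left[of "S *\<^sub>v y" n "of_real \<mu> \<cdot>\<^sub>v y" x]
      ip_commute[of x "G *\<^sub>v y"] ip_commute[of x "S *\<^sub>v y"] ip_commute[of x y] G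
    by (simp add: Gx ip_smult_left)
  define q where "q x = - Re (ip (G *\<^sub>v x) x)" for x
  have q: "q x = \<mu> * (vnorm x)\<^sup>2 - Re (ip (S *\<^sub>v x) x)" if "x \<in> carrier_vec n" for x
    using that S ip_diff_left[of "S *\<^sub>v x" n "of_real \<mu> \<cdot>\<^sub>v x" x]
    by (simp add: q_def Gx ip_smult_left ip_self del: of_real_power)
  obtain D0 where D0: "D0 \<ge> 0" "\<And>x. x \<in> carrier_vec n \<Longrightarrow> vnorm (G *\<^sub>v x) \<le> D0 * vnorm x"
    using mult_mat_vec_bounded[OF G] by blast
  \<comment> \<open>Adding 1 makes the bound strictly positive, since 1/D is used as a step length
    below.\<close>
  define D where "D = D0 + 1"
  have D: "D > 0" "\<And>x. x \<in> carrier_vec n \<Longrightarrow> q x \<le> D * (vnorm x)\<^sup>2"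
  proof -
    show "D > 0" using D0 by (simp add: D_def)
    fix x :: "complex vec" assume x: "x \<in> carrier_vec n"
    have "q x \<le> vnorm (G *\<^sub>v x) * vnorm x"
      using cmod_ip_le[of "G *\<^sub>v x" x] abs_Re_le_cmod[of "ip (G *\<^sub>v x) x"] G x by (simp add: q_def)
    also have "\<dots> \<le> D * vnorm x * vnorm x"
      using D0(2)[OF x] vnorm_nonneg[of x]
      by (intro mult_right_mono) (auto simp: D_def distrib_right intro: add_increasing2)
    finally show "q x \<le> D * (vnorm x)\<^sup>2" by (simp add: power2_eq_square)
  qed
  \<comment> \<open>The nonnegative form \<open>q\<close> is evaluated after a descent step, at z =
    x + Gx/D: 0 \<le> q(z) = q(x) - (2/D)|Gx|^2 + q(Gx)/D^2, and the last term is at most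
    |Gx|^2/D.\<close>
  have G_le: "(vnorm (G *\<^sub>v x))\<^sup>2 \<le> D * q x" if x: "x \<in> carrier_vec n" for x
  proof -
    let ?g = "G *\<^sub>v x" and ?s = "1 / D"
    let ?z = "x + of_real ?s \<cdot>\<^sub>v ?g"
    have g: "?g \<in> carrier_vec n" using G x by simp
    have Gg: "G *\<^sub>v ?g \<in> carrier_vec n" using G g by simp
    have Gz: "G *\<^sub>v ?z = ?g + of_real ?s \<cdot>\<^sub>v (G *\<^sub>v ?g)"
      using mult_add_distrib_mat_vec[OF G x, of "of_real ?s \<cdot>\<^sub>v ?g"] mult_mat_vec[OF G g] g by simp
    have right: "ip y ?z = ip y x + of_real ?s * ip y ?g" if "y \<in> carrier_vec n" for y
      using that x g G by (simp add: ip_def distrib_left sum.distrib sum_distrib_left mult_ac)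
    have "ip (G *\<^sub>v ?z) ?z = ip ?g x + of_real ?s * ip ?g ?g + of_real ?s * (ip ?g ?g + of_real ?s * ip (G *\<^sub>v ?g) ?g)"
      unfolding Gz using ip_add_left[OF g, of "of_real ?s \<cdot>\<^sub>v (G *\<^sub>v ?g)"] Gg right[OF g] right[OF Gg] Gherm[OF g x]
      by (simp add: ip_smult_left)
    then have "q ?z = q x - 2 * ?s * (vnorm ?g)\<^sup>2 + ?s\<^sup>2 * q ?g"
      by (simp add: q_def ip_self power2_eq_square algebra_simps)
    moreover have "0 \<le> q ?z"
      using le[of ?z] q[of ?z] x g by simp
    moreover have "?s\<^sup>2 * q ?g \<le> ?s\<^sup>2 * (D * (vnorm ?g)\<^sup>2)"
      using D(2)[OF g] by (intro mult_left_mono) auto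
    moreover have "?s\<^sup>2 * (D * (vnorm ?g)\<^sup>2) = ?s * (vnorm ?g)\<^sup>2"
      using D(1) by (simp add: power2_eq_square)
    ultimately have "?s * (vnorm ?g)\<^sup>2 \<le> q x" by simp
    then show ?thesis using D(1) by (simp add: field_simps)
  qed
  have "eigenvalue S (of_real \<mu>)"
  proof (rule ccontr)
    assume "\<not> eigenvalue S (of_real \<mu>)"
    then have "det G \<noteq> 0" using eigenvalue_det[OF S] by (simp add: G_def)
    then have "G \<in> Units (ring_mat TYPE(complex) n ())"
      by (rule det_non_zero_imp_unit[OF G])
    then obtain F where F: "F \<in> carrier_mat n n" "F * G = 1\<^sub>m n"
      by (auto simp: Units_def ring_mat_def)
    obtain E where E: "E \<ge> 0" "\<And>x. x \<in> carrier_vec n \<Longrightarrow> vnorm (F *\<^sub>v x) \<le> E * vnorm x"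
      using mult_mat_vec_bounded[OF F(1)] by blast
    have gap: "1 \<le> E\<^sup>2 * D * q x" if x: "x \<in> carrier_vec n" "vnorm x = 1" for x
    proof -
      have "x = F *\<^sub>v (G *\<^sub>v x)"
        using assoc_mult_mat_vec[OF F(1) G x(1)] F(2) x by simp
      then have "1 \<le> E * vnorm (G *\<^sub>v x)"
        using E(2)[of "G *\<^sub>v x"] G x by simp
      then have "1\<^sup>2 \<le> (E * vnorm (G *\<^sub>v x))\<^sup>2" by (intro power_mono) auto
      also have "\<dots> \<le> E\<^sup>2 * (D * q x)"
        using G_le[OF x(1)] by (simp add: power_mult_distrib mult_left_mono)
      finally show ?thesis by simp
    qed
    have pos: "E\<^sup>2 * D > 0"
    proof -
      have "E\<^sup>2 * D \<noteq> 0" using gap[of "unit_vec n 0"] vnorm_unit_vec[OF n] by auto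
      then show ?thesis using D(1) by (simp add: less_le)
    qed
    \<comment> \<open>The uniform gap of \<open>q\<close> on the unit sphere yields an upper bound
      of the Rayleigh quotients strictly below their supremum.\<close>
    have "\<mu> \<le> \<mu> - 1 / (E\<^sup>2 * D)"
    proof (subst (1) \<mu>_def, rule cSup_least[OF ne])
      fix r assume "r \<in> ?R"
      then obtain x where x: "x \<in> carrier_vec n" "vnorm x = 1" "r = Re (ip (S *\<^sub>v x) x)" by blast
      have "1 / (E\<^sup>2 * D) \<le> q x"
        using gap[OF x(1,2)] pos by (simp add: divide_le_eq mult_ac)
      then show "r \<le> \<mu> - 1 / (E\<^sup>2 * D)" using q[OF x(1)] x by simp
    qed
    moreover have "1 / (E\<^sup>2 * D) > 0" using pos by simp
    ultimately show False by linarith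
  qed
  moreover have "finite {k. eigenvalue S k}"
    using card_finite_spectrum(1)[OF S] by (simp add: spectrum_def)
  ultimately have "Re (of_real \<mu>) \<le> Max (Re ` {k. eigenvalue S k})"
    by (intro Max_ge) (auto simp del: Re_complex_of_real)
  then show ?thesis
    using le[OF x] by (simp add: mult_right_mono order_trans)
qed

lemma smult_mat_mult_vec:
  fixes A :: "complex mat"
  assumes "A \<in> carrier_mat r c" "x \<in> carrier_vec c"
  shows "(k \<cdot>\<^sub>m A) *\<^sub>v x = k \<cdot>\<^sub>v (A *\<^sub>v x)"
  using assms by (intro eq_vecI) (auto simp: scalar_prod_def sum_distrib_left mult_ac)

text \<open>The Hermitian part S of A satisfies Re <Sx, x> = Re <Ax, x>, so the Rayleigh bound for S
  carries over.\<close>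

lemma Re_ip_le_lognorm:
  assumes A: "A \<in> carrier_mat n n" and n: "n > 0" and x: "x \<in> carrier_vec n"
  shows "Re (ip (A *\<^sub>v x) x) \<le> lognorm A * (vnorm x)\<^sup>2"
proof -
  define S where "S = (1/2 :: complex) \<cdot>\<^sub>m (A + mat_adjoint A)"
  note Aa = mat_adjoint_carrier[OF A]
  have S: "S \<in> carrier_mat n n" using A Aa by (simp add: S_def)
  have Sx: "S *\<^sub>v x = (1/2) \<cdot>\<^sub>v (A *\<^sub>v x + mat_adjoint A *\<^sub>v x)" if "x \<in> carrier_vec n" for x
    unfolding S_def add_mult_distrib_mat_vec[OF A Aa that, symmetric]
    using A Aa that by (intro smult_mat_mult_vec[of _ n n]) auto
  have ipS: "ip (S *\<^sub>v x) y = (ip (A *\<^sub>v x) y + ip x (A *\<^sub>v y)) / 2"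
    if "x \<in> carrier_vec n" "y \<in> carrier_vec n" for x y
    using that A mult_mat_vec_carrier[OF Aa that(1)] ip_add_left[of "A *\<^sub>v x" n "mat_adjoint A *\<^sub>v x" y]
    by (simp add: Sx ip_smult_left ip_adjoint[OF A])
  have "ip (S *\<^sub>v x) y = ip x (S *\<^sub>v y)" if "x \<in> carrier_vec n" "y \<in> carrier_vec n" for x y
    using that A S ip_commute[of x "S *\<^sub>v y"] ip_commute[of x "A *\<^sub>v y"] ip_commute[of "A *\<^sub>v x" y]
    by (simp add: ipS)
  then have "Re (ip (S *\<^sub>v x) x) \<le> lognorm A * (vnorm x)\<^sup>2"
    using hermitian_rayleigh_le_max_eigenvalue[OF S n _ x] by (simp add: lognorm_def S_def)
  then show ?thesis
    using ip_commute[of x "A *\<^sub>v x"] x A by (simp add: ipS)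
qed

section \<open>Block Toeplitz matrices\<close>

definition block :: "nat \<Rightarrow> complex vec \<Rightarrow> nat \<Rightarrow> complex vec" where
  "block n x r = vec n (\<lambda>i. x $ (r * n + i))"

lemma block_carrier [simp]: "block n x r \<in> carrier_vec n"
  by (simp add: block_def)

lemma block_index_less: "r < m \<Longrightarrow> i < n \<Longrightarrow> r * n + i < m * (n::nat)"
  using mult_le_mono1[of "Suc r" m n] by simp

lemma sum_blocks:
  fixes g :: "nat \<Rightarrow> 'a :: comm_monoid_add"
  shows "(\<Sum>j<m * n. g j) = (\<Sum>r<m. \<Sum>i<n. g (r * n + i))"
  by (simp add: sum.nat_group[symmetric] sum.atLeastLessThan_shift_0[of g] atLeast0LessThan)

lemma vnorm_squared_blocks:
  assumes "x \<in> carrier_vec (m * n)"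
  shows "(vnorm x)\<^sup>2 = (\<Sum>r<m. (vnorm (block n x r))\<^sup>2)"
  using assms by (simp add: vnorm_squared sum_blocks block_def)

lemma vnorm_eq_L2_set_blocks:
  assumes "x \<in> carrier_vec (m * n)"
  shows "vnorm x = L2_set (\<lambda>r. vnorm (block n x r)) {..<m}"
  using vnorm_squared_blocks[OF assms] unfolding L2_set_def by (metis real_sqrt_unique vnorm_nonneg)

lemma ip_blocks:
  assumes "x \<in> carrier_vec (m * n)"
  shows "ip x y = (\<Sum>r<m. ip (block n x r) (block n y r))"
  using assms by (simp add: ip_def sum_blocks block_def)

lemma L2_set_sum_le:
  assumes "finite S"
  shows "L2_set (\<lambda>r. \<Sum>l\<in>S. f l r) K \<le> (\<Sum>l\<in>S. L2_set (f l) K)"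
  using assms
proof (induction S)
  case (insert a S)
  then show ?case
    using L2_set_triangle_ineq[of "f a" "\<lambda>r. \<Sum>l\<in>S. f l r" K] by simp
qed (simp add: L2_set_def)

text \<open>The shift by \<open>l\<close> block positions with zero padding; \<open>Lmat\<close> is
  the sum over \<open>l\<close> of these shifts followed by \<open>A l\<close> on every
  block.\<close>

definition shifted_block :: "nat \<Rightarrow> (nat \<Rightarrow> complex vec) \<Rightarrow> nat \<Rightarrow> nat \<Rightarrow> complex vec" where
  "shifted_block n X l r = (if l \<le> r then X (r - l) else 0\<^sub>v n)"

text \<open>Defined on infinite sequences of blocks and without \<open>m\<close>, so that it
  describes both the rows of \<open>Lmat\<close> and the Cauchy product of A(\<epsilon>) with a
  power series.\<close>

definition toeplitz_mult :: "nat \<Rightarrow> nat \<Rightarrow> (nat \<Rightarrow> complex mat) \<Rightarrow> (nat \<Rightarrow> complex vec) \<Rightarrow> nat \<Rightarrow> complex vec" where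
  "toeplitz_mult n N A X r = vec n (\<lambda>i. \<Sum>l\<le>N. (A l *\<^sub>v shifted_block n X l r) $ i)"

lemma toeplitz_mult_carrier [simp]: "toeplitz_mult n N A X r \<in> carrier_vec n"
  by (simp add: toeplitz_mult_def)

lemma toeplitz_mult_cong:
  "(\<And>s. s \<le> r \<Longrightarrow> X s = Y s) \<Longrightarrow> toeplitz_mult n N A X r = toeplitz_mult n N A Y r"
  unfolding toeplitz_mult_def shifted_block_def
  by (intro arg_cong[where f = "vec n"] ext sum.cong refl) simp

section \<open>Action of \<open>Lmat\<close> on blocks, its norm and its logarithmic norm\<close>

locale coefficient_mats =
  fixes n N :: nat and A :: "nat \<Rightarrow> complex mat"
  assumes n: "n > 0" and A: "\<And>l. l \<le> N \<Longrightarrow> A l \<in> carrier_mat n n"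
begin

lemma Lmat_carrier [simp]: "Lmat n N A m \<in> carrier_mat (m * n) (m * n)"
  by (simp add: Lmat_def)

lemma block_Lmat_mult:
  assumes x: "x \<in> carrier_vec (m * n)" and r: "r < m"
  shows "block n (Lmat n N A m *\<^sub>v x) r = toeplitz_mult n N A (block n x) r"
proof (rule eq_vecI)
  fix i assume "i < dim_vec (toeplitz_mult n N A (block n x) r)"
  then have i: "i < n" by (simp add: toeplitz_mult_def)
  \<comment> \<open>For row indices below \<open>m\<close> the difference \<open>r - s\<close> never
    exceeds \<open>m - 1\<close>, so the cutoff \<open>min (m-1) N\<close> reduces to
    \<open>N\<close>.\<close>
  have entry: "Lmat n N A m $$ (r * n + i, s * n + j) =
      (if s \<le> r \<and> r - s \<le> N then A (r - s) $$ (i, j) else 0)" if "s < m" "j < n" for s j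
    using block_index_less[OF r i] block_index_less[OF that] r i that by (auto simp: Lmat_def Let_def)
  have "block n (Lmat n N A m *\<^sub>v x) r $ i =
      (\<Sum>s<m. \<Sum>j<n. Lmat n N A m $$ (r * n + i, s * n + j) * x $ (s * n + j))"
    using mult_mat_vec_index_sum[OF Lmat_carrier x block_index_less[OF r i]] i
    by (simp add: block_def sum_blocks)
  also have "\<dots> = (\<Sum>s<m. if s \<le> r \<and> r - s \<le> N then (A (r - s) *\<^sub>v block n x s) $ i else 0)"
  proof (rule sum.cong[OF refl])
    fix s assume s: "s \<in> {..<m}"
    show "(\<Sum>j<n. Lmat n N A m $$ (r * n + i, s * n + j) * x $ (s * n + j)) =
      (if s \<le> r \<and> r - s \<le> N then (A (r - s) *\<^sub>v block n x s) $ i else 0)"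
    proof (cases "s \<le> r \<and> r - s \<le> N")
      case True
      then have "(A (r - s) *\<^sub>v block n x s) $ i = (\<Sum>j<n. A (r - s) $$ (i,j) * block n x s $ j)"
        using A i by (intro mult_mat_vec_index_sum) auto
      then show ?thesis using True s entry by (simp add: block_def)
    qed (use s entry in auto)
  qed
  also have "\<dots> = (\<Sum>s | s < m \<and> s \<le> r \<and> r - s \<le> N. (A (r - s) *\<^sub>v block n x s) $ i)"
    by (intro sum.mono_neutral_cong_right) auto
  also have "\<dots> = (\<Sum>l | l \<le> N \<and> l \<le> r. (A l *\<^sub>v block n x (r - l)) $ i)"
    using r by (intro sum.reindex_bij_witness[of _ "\<lambda>l. r - l" "\<lambda>s. r - s"]) auto
  also have "\<dots> = (\<Sum>l\<le>N. (A l *\<^sub>v shifted_block n (block n x) l r) $ i)"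
  proof (intro sum.mono_neutral_cong_left)
    show "\<forall>l\<in>{..N} - {l. l \<le> N \<and> l \<le> r}. (A l *\<^sub>v shifted_block n (block n x) l r) $ i = 0"
      using i by (auto simp: shifted_block_def mult_mat_vec_index_sum[OF A zero_carrier_vec]
          simp del: index_mult_mat_vec)
  qed (auto simp: shifted_block_def)
  finally show "block n (Lmat n N A m *\<^sub>v x) r $ i = toeplitz_mult n N A (block n x) r $ i"
    using i by (simp add: toeplitz_mult_def)
qed (simp_all add: block_def toeplitz_mult_def)

lemma shifted_block_carrier [simp]:
  "(\<And>s. X s \<in> carrier_vec n) \<Longrightarrow> shifted_block n X l r \<in> carrier_vec n"
  by (simp add: shifted_block_def)

lemma vnorm_toeplitz_mult_le:
  assumes "\<And>s. X s \<in> carrier_vec n"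
  shows "vnorm (toeplitz_mult n N A X r) \<le> (\<Sum>l\<le>N. opnorm (A l) * vnorm (shifted_block n X l r))"
proof -
  have "vnorm (toeplitz_mult n N A X r) \<le> (\<Sum>l\<le>N. vnorm (vec n (\<lambda>i. (A l *\<^sub>v shifted_block n X l r) $ i)))"
    unfolding toeplitz_mult_def by (rule vnorm_sum_le) simp
  also have "\<dots> \<le> (\<Sum>l\<le>N. opnorm (A l) * vnorm (shifted_block n X l r))"
  proof (rule sum_mono)
    fix l assume "l \<in> {..N}"
    then have Al: "A l \<in> carrier_mat n n" using A by simp
    then have "vec n (\<lambda>i. (A l *\<^sub>v shifted_block n X l r) $ i) = A l *\<^sub>v shifted_block n X l r"
      by (intro eq_vecI) auto
    then show "vnorm (vec n (\<lambda>i. (A l *\<^sub>v shifted_block n X l r) $ i)) \<le> opnorm (A l) * vnorm (shifted_block n X l r)"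
      using vnorm_mult_mat_vec_le_opnorm[OF Al] assms by simp
  qed
  finally show ?thesis .
qed

text \<open>Shifting only pushes the last \<open>l\<close> blocks out of range and fills with zeros,
  so it is a contraction.\<close>

lemma L2_set_shifted_block_le:
  assumes x: "x \<in> carrier_vec (m * n)"
  shows "L2_set (\<lambda>r. vnorm (shifted_block n (block n x) l r)) {..<m} \<le> vnorm x"
proof -
  have "(\<Sum>r<m. (vnorm (shifted_block n (block n x) l r))\<^sup>2) = (\<Sum>r\<in>{l..<m}. (vnorm (block n x (r - l)))\<^sup>2)"
    by (intro sum.mono_neutral_cong_right) (auto simp: shifted_block_def)
  also have "\<dots> = (\<Sum>s<m - l. (vnorm (block n x s))\<^sup>2)"
    by (intro sum.reindex_bij_witness[of _ "\<lambda>s. s + l" "\<lambda>r. r - l"]) auto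
  also have "\<dots> \<le> (\<Sum>s<m. (vnorm (block n x s))\<^sup>2)"
    by (intro sum_mono2) auto
  finally show ?thesis
    unfolding vnorm_eq_L2_set_blocks[OF x] L2_set_def by simp
qed

lemma vnorm_Lmat_mult_le:
  assumes x: "x \<in> carrier_vec (m * n)"
  shows "vnorm (Lmat n N A m *\<^sub>v x) \<le> (\<Sum>l\<le>N. opnorm (A l)) * vnorm x"
proof -
  have Lx: "Lmat n N A m *\<^sub>v x \<in> carrier_vec (m * n)"
    using x by (intro mult_mat_vec_carrier[OF Lmat_carrier])
  have "vnorm (Lmat n N A m *\<^sub>v x) = L2_set (\<lambda>r. vnorm (toeplitz_mult n N A (block n x) r)) {..<m}"
    unfolding vnorm_eq_L2_set_blocks[OF Lx] by (intro L2_set_cong) (auto simp: block_Lmat_mult[OF x])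
  also have "\<dots> \<le> L2_set (\<lambda>r. \<Sum>l\<le>N. opnorm (A l) * vnorm (shifted_block n (block n x) l r)) {..<m}"
    by (intro L2_set_mono vnorm_toeplitz_mult_le) auto
  also have "\<dots> \<le> (\<Sum>l\<le>N. L2_set (\<lambda>r. opnorm (A l) * vnorm (shifted_block n (block n x) l r)) {..<m})"
    by (rule L2_set_sum_le) simp
  also have "\<dots> = (\<Sum>l\<le>N. opnorm (A l) * L2_set (\<lambda>r. vnorm (shifted_block n (block n x) l r)) {..<m})"
    using opnorm_nonneg[OF A n] by (simp add: L2_set_right_distrib)
  also have "\<dots> \<le> (\<Sum>l\<le>N. opnorm (A l) * vnorm x)"
    using opnorm_nonneg[OF A n] by (intro sum_mono mult_left_mono L2_set_shifted_block_le[OF x]) auto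
  finally show ?thesis by (simp add: sum_distrib_right)
qed

text \<open>The term \<open>l = 0\<close> is block diagonal and is controlled by the logarithmic
  norm of \<open>A 0\<close>. Each other term is \<open>A l\<close> after a contraction, so
  Cauchy-Schwarz over the blocks costs \<open>opnorm (A l)\<close>.\<close>

lemma Re_ip_Lmat_mult_le:
  assumes x: "x \<in> carrier_vec (m * n)"
  shows "Re (ip (Lmat n N A m *\<^sub>v x) x) \<le> (lognorm (A 0) + (\<Sum>l\<in>{1..N}. opnorm (A l))) * (vnorm x)\<^sup>2"
proof -
  let ?sh = "shifted_block n (block n x)"
  have Lx: "Lmat n N A m *\<^sub>v x \<in> carrier_vec (m * n)"
    using x by (intro mult_mat_vec_carrier[OF Lmat_carrier])
  have "ip (Lmat n N A m *\<^sub>v x) x = (\<Sum>r<m. ip (toeplitz_mult n N A (block n x) r) (block n x r))"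
    unfolding ip_blocks[OF Lx] by (simp add: block_Lmat_mult[OF x])
  also have "\<dots> = (\<Sum>r<m. \<Sum>l\<le>N. ip (A l *\<^sub>v ?sh l r) (block n x r))"
  proof (rule sum.cong[OF refl])
    fix r
    have "ip (A l *\<^sub>v ?sh l r) (block n x r) = (\<Sum>i<n. (A l *\<^sub>v ?sh l r) $ i * cnj (block n x r $ i))" if "l \<le> N" for l
      using A[OF that] by (simp add: ip_def)
    then show "ip (toeplitz_mult n N A (block n x) r) (block n x r) = (\<Sum>l\<le>N. ip (A l *\<^sub>v ?sh l r) (block n x r))"
      by (simp add: ip_def toeplitz_mult_def sum_distrib_right del: index_mult_mat_vec) (rule sum.swap)
  qed
  also have "\<dots> = (\<Sum>l\<le>N. \<Sum>r<m. ip (A l *\<^sub>v ?sh l r) (block n x r))"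
    by (rule sum.swap)
  also have "\<dots> = (\<Sum>r<m. ip (A 0 *\<^sub>v ?sh 0 r) (block n x r)) + (\<Sum>l\<in>{1..N}. \<Sum>r<m. ip (A l *\<^sub>v ?sh l r) (block n x r))"
    by (simp add: sum.atMost_shift sum.atLeast_Suc_atMost_Suc_shift[symmetric] sum.atLeast1_atMost_eq)
  finally have "Re (ip (Lmat n N A m *\<^sub>v x) x) =
      (\<Sum>r<m. Re (ip (A 0 *\<^sub>v block n x r) (block n x r)))
      + (\<Sum>l\<in>{1..N}. \<Sum>r<m. Re (ip (A l *\<^sub>v ?sh l r) (block n x r)))"
    by (simp add: shifted_block_def)
  also have "(\<Sum>r<m. Re (ip (A 0 *\<^sub>v block n x r) (block n x r))) \<le> (\<Sum>r<m. lognorm (A 0) * (vnorm (block n x r))\<^sup>2)"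
    using A n by (intro sum_mono Re_ip_le_lognorm) auto
  also have "\<dots> = lognorm (A 0) * (vnorm x)\<^sup>2"
    by (simp add: vnorm_squared_blocks[OF x] sum_distrib_left)
  also have "(\<Sum>l\<in>{1..N}. \<Sum>r<m. Re (ip (A l *\<^sub>v ?sh l r) (block n x r))) \<le> (\<Sum>l\<in>{1..N}. opnorm (A l) * (vnorm x)\<^sup>2)"
  proof (rule sum_mono)
    fix l assume "l \<in> {1..N}"
    then have Al: "A l \<in> carrier_mat n n" using A by simp
    \<comment> \<open>The absolute values bring the sum into the form of the Cauchy-Schwarz
      inequality \<open>L2_set_mult_ineq\<close>.\<close>
    have "(\<Sum>r<m. Re (ip (A l *\<^sub>v ?sh l r) (block n x r)))
        \<le> (\<Sum>r<m. opnorm (A l) * (\<bar>vnorm (?sh l r)\<bar> * \<bar>vnorm (block n x r)\<bar>))"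
    proof (rule sum_mono)
      fix r
      have "Re (ip (A l *\<^sub>v ?sh l r) (block n x r)) \<le> vnorm (A l *\<^sub>v ?sh l r) * vnorm (block n x r)"
        using Al by (intro order_trans[OF complex_Re_le_cmod] cmod_ip_le) (auto simp: block_def)
      also have "\<dots> \<le> opnorm (A l) * vnorm (?sh l r) * vnorm (block n x r)"
        by (intro mult_right_mono vnorm_mult_mat_vec_le_opnorm[OF Al]) auto
      finally show "Re (ip (A l *\<^sub>v ?sh l r) (block n x r)) \<le> opnorm (A l) * (\<bar>vnorm (?sh l r)\<bar> * \<bar>vnorm (block n x r)\<bar>)"
        by simp
    qed
    also have "\<dots> \<le> opnorm (A l) * (L2_set (\<lambda>r. vnorm (?sh l r)) {..<m} * L2_set (\<lambda>r. vnorm (block n x r)) {..<m})"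
      unfolding sum_distrib_left[symmetric]
      using opnorm_nonneg[OF Al n] by (intro mult_left_mono L2_set_mult_ineq)
    also have "\<dots> \<le> opnorm (A l) * (vnorm x)\<^sup>2"
      unfolding vnorm_eq_L2_set_blocks[OF x, symmetric] power2_eq_square
      using opnorm_nonneg[OF Al n] by (intro mult_left_mono mult_right_mono L2_set_shifted_block_le[OF x]) auto
    finally show "(\<Sum>r<m. Re (ip (A l *\<^sub>v ?sh l r) (block n x r))) \<le> opnorm (A l) * (vnorm x)\<^sup>2" .
  qed
  finally show ?thesis by (simp add: distrib_right sum_distrib_right)
qed

end

section \<open>Coefficients of the exponential\<close>

text \<open>\<open>power_coeff n N A u j l\<close> is the coefficient of \<open>\<epsilon>\<^sup>l\<close> in \<open>A(\<epsilon>)\<^sup>j u\<close>; multiplication by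
  \<open>A(\<epsilon>)\<close> acts on coefficient sequences exactly as \<open>L\<^sub>m\<close> acts on blocks.\<close>

primrec power_coeff :: "nat \<Rightarrow> nat \<Rightarrow> (nat \<Rightarrow> complex mat) \<Rightarrow> complex vec \<Rightarrow> nat \<Rightarrow> nat \<Rightarrow> complex vec" where
  "power_coeff n N A u 0 = (\<lambda>l. if l = 0 then u else 0\<^sub>v n)"
| "power_coeff n N A u (Suc j) = toeplitz_mult n N A (power_coeff n N A u j)"

text \<open>Convergence at z = 1 gives both formal power series a positive radius, and agreement
  near 0 then identifies them. This supplies the uniqueness behind the \<open>THE\<close> in
  \<open>coeffs\<close>.\<close>

lemma powser_everywhere_unique:
  fixes a b :: "nat \<Rightarrow> complex"
  assumes "\<And>z. (\<lambda>l. z ^ l * a l) sums f z" "\<And>z. (\<lambda>l. z ^ l * b l) sums f z"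
  shows "a = b"
proof -
  have "Abs_fps a = Abs_fps b"
  proof (rule eval_fps_eqD)
    have "ereal (norm (1::complex)) \<le> conv_radius a" "ereal (norm (1::complex)) \<le> conv_radius b"
      using assms[of 1] by (intro conv_radius_geI; simp add: sums_iff)+
    then show "fps_conv_radius (Abs_fps a) > 0" "fps_conv_radius (Abs_fps b) > 0"
      using less_le_trans[of 0 "ereal (norm (1::complex))"] by (simp_all add: fps_conv_radius_def)
    show "\<forall>\<^sub>F z in nhds 0. eval_fps (Abs_fps a) z = eval_fps (Abs_fps b) z"
      using sums_unique[OF assms(1)] sums_unique[OF assms(2)]
      by (simp add: eval_fps_def mult.commute)
  qed
  then show ?thesis by (simp add: fps_eq_iff fun_eq_iff)
qed

context coefficient_mats
begin

lemma power_coeff_carrier [simp]: "u \<in> carrier_vec n \<Longrightarrow> power_coeff n N A u j l \<in> carrier_vec n"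
  by (cases j) auto

text \<open>No truncation error occurs: by triangularity, row \<open>r\<close> involves only
  coefficients with index at most \<open>r\<close>.\<close>

lemma block_Lmat_power:
  assumes u: "u \<in> carrier_vec n" and r: "r < m"
  shows "block n ((Lmat n N A m ^\<^sub>m j) *\<^sub>v vec (m * n) (\<lambda>i. if i < n then u $ i else 0)) r
    = power_coeff n N A u j r"
  using r
proof (induction j arbitrary: r)
  case 0
  have "r * n + i < n \<longleftrightarrow> r = 0" if "i < n" for i
    using that by (cases r) auto
  then show ?case
    using u 0 block_index_less[OF 0]
    by (intro eq_vecI) (auto simp: block_def one_mult_mat_vec[of _ "m * n"] Lmat_def)
next
  case (Suc j)
  let ?v = "vec (m * n) (\<lambda>i. if i < n then u $ i else 0)"
  have c: "(Lmat n N A m ^\<^sub>m j) *\<^sub>v ?v \<in> carrier_vec (m * n)"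
    by (rule mult_mat_vec_carrier[OF pow_carrier_mat[OF Lmat_carrier]]) simp
  show ?case
    using Suc block_Lmat_mult[OF c Suc.prems]
      pow_mat_Suc_mult_vec[OF Lmat_carrier[of m], of ?v j]
    by (simp del: pow_mat.simps) (rule toeplitz_mult_cong, simp)
qed

text \<open>A(z)^j u is a polynomial in z, but treating it as a series avoids tracking degrees.
  Shifting a coefficient sequence by \<open>h\<close> multiplies its sum by z^h, which gives the
  induction step.\<close>

lemma sums_Aeps_power:
  assumes u: "u \<in> carrier_vec n" and i: "i < n"
  shows "(\<lambda>l. z ^ l * power_coeff n N A u j l $ i) sums ((Aeps n N A z ^\<^sub>m j) *\<^sub>v u) $ i"
  using i
proof (induction j arbitrary: i)
  case 0
  have "(\<lambda>l. z ^ l * power_coeff n N A u 0 l $ i) = (\<lambda>l. if l = 0 then u $ i else 0)"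
    using 0 by auto
  then show ?case
    using sums_single[of 0 "\<lambda>_. u $ i"] u by (simp add: Aeps_def)
next
  case (Suc j)
  let ?X = "power_coeff n N A u j" and ?Z = "Aeps n N A z"
  let ?w = "(?Z ^\<^sub>m j) *\<^sub>v u"
  have Z: "?Z \<in> carrier_mat n n" by (simp add: Aeps_def)
  have w: "?w \<in> carrier_vec n"
    using u by (intro mult_mat_vec_carrier[OF pow_carrier_mat[OF Z]])
  have shift: "(\<lambda>l. z ^ l * shifted_block n ?X h l $ k) sums (z ^ h * ?w $ k)" if "k < n" for h k
  proof -
    have "(\<lambda>l. z ^ (l + h) * shifted_block n ?X h (l + h) $ k) sums (z ^ h * ?w $ k)"
      using sums_mult[OF Suc.IH[OF that], of "z ^ h"] by (simp add: shifted_block_def power_add mult_ac)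
    then show ?thesis
      using that by (subst (asm) sums_zero_iff_shift) (auto simp: shifted_block_def)
  qed
  have "(\<lambda>l. \<Sum>h\<le>N. \<Sum>k<n. A h $$ (i,k) * (z ^ l * shifted_block n ?X h l $ k))
      sums (\<Sum>h\<le>N. \<Sum>k<n. A h $$ (i,k) * (z ^ h * ?w $ k))"
    by (intro sums_sum sums_mult shift) simp
  moreover have "z ^ l * toeplitz_mult n N A ?X l $ i
      = (\<Sum>h\<le>N. \<Sum>k<n. A h $$ (i,k) * (z ^ l * shifted_block n ?X h l $ k))" for l
  proof -
    have "(A h *\<^sub>v shifted_block n ?X h l) $ i = (\<Sum>k<n. A h $$ (i,k) * shifted_block n ?X h l $ k)" if "h \<le> N" for h
      using A[OF that] u Suc.prems by (intro mult_mat_vec_index_sum) auto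
    then show ?thesis
      using Suc.prems by (simp add: toeplitz_mult_def sum_distrib_left mult_ac del: index_mult_mat_vec)
  qed
  moreover have "((?Z ^\<^sub>m Suc j) *\<^sub>v u) $ i = (\<Sum>h\<le>N. \<Sum>k<n. A h $$ (i,k) * (z ^ h * ?w $ k))"
  proof -
    have "((?Z ^\<^sub>m Suc j) *\<^sub>v u) $ i = (\<Sum>k<n. ?Z $$ (i,k) * ?w $ k)"
      unfolding pow_mat_Suc_mult_vec[OF Z u] using mult_mat_vec_index_sum[OF Z w Suc.prems] .
    also have "\<dots> = (\<Sum>k<n. \<Sum>h\<le>N. A h $$ (i,k) * (z ^ h * ?w $ k))"
      using Suc.prems by (simp add: Aeps_def sum_distrib_right mult_ac)
    also have "\<dots> = (\<Sum>h\<le>N. \<Sum>k<n. A h $$ (i,k) * (z ^ h * ?w $ k))" by (rule sum.swap)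
    finally show ?thesis .
  qed
  ultimately show ?case by (simp only: power_coeff.simps)
qed

text \<open>Submultiplicativity of the weighted l1 norm under Cauchy products, stated for partial
  sums uniformly in \<open>K\<close>. Taking R = |z| gives absolute convergence in \<open>l\<close>,
  and R = 1 bounds a single coefficient.\<close>

lemma sum_power_coeff_le:
  assumes u: "u \<in> carrier_vec n" and R: "0 \<le> R"
  shows "(\<Sum>l<K. R ^ l * vnorm (power_coeff n N A u j l)) \<le> (\<Sum>h\<le>N. R ^ h * opnorm (A h)) ^ j * vnorm u"
proof (induction j arbitrary: K)
  case 0
  have "(\<Sum>l<K. R ^ l * vnorm (power_coeff n N A u 0 l)) = (\<Sum>l<K. if l = 0 then vnorm u else 0)"
    by (intro sum.cong) auto
  then show ?case by simp
next
  case (Suc j)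
  let ?X = "power_coeff n N A u j"
  let ?S = "\<Sum>h\<le>N. R ^ h * opnorm (A h)"
  have op: "0 \<le> opnorm (A h)" if "h \<le> N" for h using opnorm_nonneg[OF A n] that by simp
  have "(\<Sum>l<K. R ^ l * vnorm (power_coeff n N A u (Suc j) l))
      \<le> (\<Sum>l<K. R ^ l * (\<Sum>h\<le>N. opnorm (A h) * vnorm (shifted_block n ?X h l)))"
    using R u by (intro sum_mono mult_left_mono) (auto intro!: vnorm_toeplitz_mult_le)
  also have "\<dots> = (\<Sum>h\<le>N. opnorm (A h) * (\<Sum>l<K. R ^ l * vnorm (shifted_block n ?X h l)))"
    unfolding sum_distrib_left by (subst sum.swap) (simp add: mult_ac)
  also have "\<dots> \<le> (\<Sum>h\<le>N. opnorm (A h) * (R ^ h * (?S ^ j * vnorm u)))"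
  proof (intro sum_mono mult_left_mono)
    fix h assume "h \<in> {..N}"
    have "(\<Sum>l<K. R ^ l * vnorm (shifted_block n ?X h l)) = (\<Sum>l\<in>{h..<K}. R ^ l * vnorm (?X (l - h)))"
      by (intro sum.mono_neutral_cong_right) (auto simp: shifted_block_def)
    also have "\<dots> = (\<Sum>s<K - h. R ^ h * (R ^ s * vnorm (?X s)))"
      by (intro sum.reindex_bij_witness[of _ "\<lambda>s. s + h" "\<lambda>r. r - h"])
        (auto simp flip: power_add mult.assoc)
    also have "\<dots> \<le> R ^ h * (?S ^ j * vnorm u)"
      using R Suc by (simp flip: sum_distrib_left add: mult_left_mono)
    finally show "(\<Sum>l<K. R ^ l * vnorm (shifted_block n ?X h l)) \<le> R ^ h * (?S ^ j * vnorm u)" .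
  qed (use op in auto)
  also have "\<dots> = ?S ^ Suc j * vnorm u"
    by (simp add: sum_distrib_left sum_distrib_right mult_ac)
  finally show ?case .
qed

lemma vnorm_power_coeff_le:
  assumes u: "u \<in> carrier_vec n"
  shows "vnorm (power_coeff n N A u j l) \<le> (\<Sum>h\<le>N. opnorm (A h)) ^ j * vnorm u"
proof -
  have "vnorm (power_coeff n N A u j l) \<le> (\<Sum>l<Suc l. 1 ^ l * vnorm (power_coeff n N A u j l))"
    by (simp add: sum_nonneg)
  then show ?thesis using sum_power_coeff_le[OF u, where R = 1 and K = "Suc l" and j = j] by simp
qed

text \<open>The candidate for the coefficient of z^l in exp(sA(z))u, obtained by formally
  interchanging the sums over \<open>j\<close> and \<open>l\<close>.\<close>

definition exp_coeff :: "complex vec \<Rightarrow> complex \<Rightarrow> nat \<Rightarrow> complex vec" where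
  "exp_coeff u s l = vec n (\<lambda>i. \<Sum>j. s ^ j / fact j * power_coeff n N A u j l $ i)"

lemma mexpv_Lmat_index:
  assumes u: "u \<in> carrier_vec n" and r: "r < m" and i: "i < n"
  shows "mexpv s (Lmat n N A m) (vec (m * n) (\<lambda>i. if i < n then u $ i else 0)) $ (r * n + i)
    = exp_coeff u s r $ i"
proof -
  have "((Lmat n N A m ^\<^sub>m j) *\<^sub>v vec (m * n) (\<lambda>i. if i < n then u $ i else 0)) $ (r * n + i)
      = power_coeff n N A u j r $ i" for j
    using arg_cong[OF block_Lmat_power[OF u r, of j], of "\<lambda>x. x $ i"] i by (simp add: block_def)
  then show ?thesis
    using block_index_less[OF r i] i by (simp add: mexpv_def exp_coeff_def)
qed

text \<open>Fubini for the double family \<open>F\<close>: summing over \<open>l\<close> first gives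
  the exponential series, summing over \<open>j\<close> first gives the coefficients. Absolute
  summability holds because row \<open>j\<close> has norm sum at most (|s| S)^j/j! times |u|, where
  S is the sum of |z|^h \<open>opnorm (A h)\<close>.\<close>

lemma sums_exp_coeff:
  assumes u: "u \<in> carrier_vec n" and i: "i < n"
  shows "(\<lambda>l. z ^ l * exp_coeff u s l $ i) sums (mexpv s (Aeps n N A z) u $ i)"
proof -
  define F where "F = (\<lambda>(j,l). s ^ j / fact j * (z ^ l * power_coeff n N A u j l $ i))"
  let ?S = "\<Sum>h\<le>N. cmod z ^ h * opnorm (A h)" and ?S1 = "\<Sum>h\<le>N. opnorm (A h)"
  have entry: "cmod (power_coeff n N A u j l $ i) \<le> vnorm (power_coeff n N A u j l)" for j l
    using carrier_vecD[OF power_coeff_carrier[OF u, of j l]] i by (intro cmod_index_le_vnorm) (simp only:)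
  have partial: "(\<Sum>l<K. norm (z ^ l * power_coeff n N A u j l $ i)) \<le> ?S ^ j * vnorm u" for j K
  proof -
    have "(\<Sum>l<K. norm (z ^ l * power_coeff n N A u j l $ i)) \<le> (\<Sum>l<K. cmod z ^ l * vnorm (power_coeff n N A u j l))"
      using entry by (intro sum_mono) (simp add: norm_mult norm_power mult_left_mono)
    also have "\<dots> \<le> ?S ^ j * vnorm u" by (rule sum_power_coeff_le[OF u]) simp
    finally show ?thesis .
  qed
  have row_summable: "summable (\<lambda>l. norm (z ^ l * power_coeff n N A u j l $ i))" for j
    by (rule summableI_nonneg_bounded[OF norm_ge_zero partial])
  have row_bound: "(\<Sum>l. norm (z ^ l * power_coeff n N A u j l $ i)) \<le> ?S ^ j * vnorm u" for j
    by (rule suminf_le_const[OF row_summable partial])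
  have row: "((\<lambda>l. F (j, l)) has_sum (s ^ j / fact j * ((Aeps n N A z ^\<^sub>m j) *\<^sub>v u) $ i)) UNIV" for j
    unfolding F_def prod.case
    by (intro has_sum_cmult_right norm_summable_imp_has_sum row_summable sums_Aeps_power[OF u i])
  have column: "((\<lambda>j. F (j, l)) has_sum (z ^ l * exp_coeff u s l $ i)) UNIV" for l
  proof -
    have sm: "summable (\<lambda>j. norm (s ^ j / fact j * power_coeff n N A u j l $ i))"
    proof (rule summable_comparison_test')
      show "summable (\<lambda>j. vnorm u * (inverse (fact j) * (?S1 * cmod s) ^ j))"
        by (intro summable_mult summable_exp)
      fix j
      have "cmod s ^ j / fact j * cmod (power_coeff n N A u j l $ i) \<le> cmod s ^ j / fact j * (?S1 ^ j * vnorm u)"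
        using order_trans[OF entry vnorm_power_coeff_le[OF u]] by (intro mult_left_mono) auto
      then show "norm (norm (s ^ j / fact j * power_coeff n N A u j l $ i)) \<le> vnorm u * (inverse (fact j) * (?S1 * cmod s) ^ j)"
        by (simp add: norm_mult norm_divide norm_power power_mult_distrib field_simps)
    qed
    have "(\<lambda>j. s ^ j / fact j * power_coeff n N A u j l $ i) sums (exp_coeff u s l $ i)"
      using summable_sums[OF summable_norm_cancel[OF sm]] i by (simp add: exp_coeff_def)
    then have "((\<lambda>j. z ^ l * (s ^ j / fact j * power_coeff n N A u j l $ i)) has_sum (z ^ l * exp_coeff u s l $ i)) UNIV"
      by (intro has_sum_cmult_right norm_summable_imp_has_sum sm)
    then show ?thesis by (simp add: F_def mult_ac)
  qed
  have "(\<lambda>x. norm (F x)) summable_on (UNIV \<times> UNIV)"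
  proof (rule summable_on_SigmaI)
    let ?g = "\<lambda>j. cmod (s ^ j / fact j) * (\<Sum>l. norm (z ^ l * power_coeff n N A u j l $ i))"
    show "((\<lambda>l. norm (F (j, l))) has_sum ?g j) UNIV" for j
      unfolding F_def prod.case norm_mult[of "s ^ j / fact j"]
      by (intro has_sum_cmult_right norm_summable_imp_has_sum summable_sums row_summable) (simp add: row_summable)
    have "summable ?g"
    proof (rule summable_comparison_test')
      show "summable (\<lambda>j. vnorm u * (inverse (fact j) * (?S * cmod s) ^ j))"
        by (intro summable_mult summable_exp)
      fix j
      have "?g j \<le> cmod (s ^ j / fact j) * (?S ^ j * vnorm u)"
        by (intro mult_left_mono row_bound) auto
      moreover have "0 \<le> ?g j" by (intro mult_nonneg_nonneg suminf_nonneg row_summable) auto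
      ultimately show "norm (?g j) \<le> vnorm u * (inverse (fact j) * (?S * cmod s) ^ j)"
        by (simp add: norm_divide norm_power power_mult_distrib field_simps)
    qed
    moreover have "0 \<le> ?g j" for j
      by (intro mult_nonneg_nonneg suminf_nonneg row_summable) auto
    ultimately show "?g summable_on UNIV"
      by (intro norm_summable_imp_summable_on) simp
  qed simp
  then have "F summable_on (UNIV \<times> UNIV)" by (rule abs_summable_summable)
  then obtain T where T: "(F has_sum T) (UNIV \<times> UNIV)" unfolding summable_on_def by blast
  have "((\<lambda>j. s ^ j / fact j * ((Aeps n N A z ^\<^sub>m j) *\<^sub>v u) $ i) has_sum T) UNIV"
    by (rule has_sum_SigmaD[OF T row])
  then have "mexpv s (Aeps n N A z) u $ i = T"
    using has_sum_imp_sums[THEN sums_unique] u i by (fastforce simp: mexpv_def)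
  moreover have "((\<lambda>l. z ^ l * exp_coeff u s l $ i) has_sum T) UNIV"
    using has_sum_SigmaD[OF T[unfolded has_sum_swap[of F]]] column by simp
  ultimately show ?thesis using has_sum_imp_sums by blast
qed

lemma coeffs_eq_exp_coeff:
  assumes u: "u \<in> carrier_vec n"
  shows "coeffs n N A u t = exp_coeff u (of_real t)"
  unfolding coeffs_def
proof (rule the_equality)
  show "(\<forall>l. exp_coeff u (of_real t) l \<in> carrier_vec n) \<and> (\<forall>\<epsilon> i. i < n \<longrightarrow>
      (\<lambda>l. \<epsilon> ^ l * exp_coeff u (of_real t) l $ i) sums (mexpv (of_real t) (Aeps n N A \<epsilon>) u $ i))"
    using sums_exp_coeff[OF u] by (simp add: exp_coeff_def)
next
  fix c assume c: "(\<forall>l. c l \<in> carrier_vec n) \<and> (\<forall>\<epsilon> i. i < n \<longrightarrow>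
      (\<lambda>l. \<epsilon> ^ l * c l $ i) sums (mexpv (of_real t) (Aeps n N A \<epsilon>) u $ i))"
  have "(\<lambda>l. c l $ i) = (\<lambda>l. exp_coeff u (of_real t) l $ i)" if "i < n" for i
    using that c sums_exp_coeff[OF u that] by (intro powser_everywhere_unique) auto
  then have "c l $ i = exp_coeff u (of_real t) l $ i" if "i < n" for i l
    using that by (meson fun_cong)
  then show "c = exp_coeff u (of_real t)"
    using c by (intro ext eq_vecI) (auto simp: exp_coeff_def)
qed

end

section \<open>Weighted sum of the first \<open>k\<close> blocks of the Arnoldi error\<close>

theorem mainTheorem4:
  fixes n N m p k :: nat and A :: "nat \<Rightarrow> complex mat" and u0 :: "complex vec"
    and t :: real and Q H :: "complex mat" and \<epsilon> :: complex
  assumes "N \<ge> 1"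
    and "\<And>i. i \<le> N \<Longrightarrow> A i \<in> carrier_mat n n"
    and "u0 \<in> carrier_vec n" and "u0 \<noteq> 0\<^sub>v n"
    and "t > 0" and "p \<ge> 1" and "k \<ge> 1" and "m \<ge> k"
    and "arnoldi_result (Lmat n N A m) (vec (m*n) (\<lambda>i. if i < n then u0 $ i else 0)) p Q H"
    and "cmod \<epsilon> \<noteq> 1"
  shows
    "(let c = coeffs n N A u0 t;
          w = of_real (vnorm u0) \<cdot>\<^sub>v (Q *\<^sub>v mexpv (of_real t) H (unit_vec p 0));
          ct = (\<lambda>l. vec n (\<lambda>i. w $ (l*n + i)));
          \<alpha> = (\<Sum>l\<le>N. opnorm (A l));
          \<beta> = lognorm (A 0) + (\<Sum>l\<in>{1..N}. opnorm (A l))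
      in vnorm (vec n (\<lambda>i. \<Sum>l<k. \<epsilon>^l * (c l $ i - ct l $ i)))
         \<le> 2 * sqrt ((1 - cmod \<epsilon> ^ (2*k)) / (1 - cmod \<epsilon> ^ 2))
             * ((t * \<alpha>)^p * exp (t * max 1 \<beta>) / fact p) * vnorm u0)"
proof -
  have n: "n > 0" using assms(3,4) by (cases n) auto
  interpret coefficient_mats n N A
    using n assms(2) by unfold_locales
  define v0 where "v0 = vec (m*n) (\<lambda>i. if i < n then u0 $ i else 0)"
  define w where "w = of_real (vnorm u0) \<cdot>\<^sub>v (Q *\<^sub>v mexpv (of_real t) H (unit_vec p 0))"
  define \<alpha> where "\<alpha> = (\<Sum>l\<le>N. opnorm (A l))"
  define \<beta> where "\<beta> = lognorm (A 0) + (\<Sum>l\<in>{1..N}. opnorm (A l))"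
  \<comment> \<open>Being at least 1, \<open>b\<close> meets the nonnegativity condition of the
    Arnoldi estimate even when \<open>\<beta>\<close> is negative.\<close>
  define b where "b = max 1 \<beta>"
  define err where "err = mexpv (of_real t) (Lmat n N A m) v0 - w"
  have m: "m > 0" using assms(7,8) by simp
  have v0: "v0 \<in> carrier_vec (m * n)" by (simp add: v0_def)
  have ar: "arnoldi_result (Lmat n N A m) v0 p Q H" using assms(9) by (simp add: v0_def)
  have norm_v0: "vnorm v0 = vnorm u0"
  proof -
    \<comment> \<open>The zeroth power of \<open>Lmat\<close> in \<open>block_Lmat_power\<close>
      reads off the blocks of \<open>v0\<close> itself.\<close>
    have "vnorm (block n v0 r) = (if r = 0 then vnorm u0 else 0)" if "r < m" for r
      using block_Lmat_power[OF assms(3) that, of 0] v0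
      by (simp add: v0_def one_mult_mat_vec[of _ "m * n"] Lmat_def)
    then have "(vnorm v0)\<^sup>2 = (\<Sum>r<m. if r = 0 then (vnorm u0)\<^sup>2 else 0)"
      unfolding vnorm_squared_blocks[OF v0] by (intro sum.cong) auto
    then show ?thesis using m by simp
  qed
  have v0_nz: "v0 \<noteq> 0\<^sub>v (m * n)"
    using norm_v0 vnorm_eq_0_iff[OF v0] vnorm_eq_0_iff[OF assms(3)] assms(4) by simp
  have "bounded_mat (Lmat n N A m) (m * n) \<alpha>"
    using vnorm_Lmat_mult_le opnorm_nonneg[OF A n]
    by unfold_locales (auto simp: \<alpha>_def intro!: sum_nonneg)
  moreover have "Re (ip (Lmat n N A m *\<^sub>v x) x) \<le> b * (vnorm x)\<^sup>2" if "x \<in> carrier_vec (m * n)" for x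
    using Re_ip_Lmat_mult_le[OF that] mult_right_mono[of \<beta> b "(vnorm x)\<^sup>2"]
    by (simp add: b_def \<beta>_def)
  ultimately have err_le: "vnorm err \<le> 2 * ((t * \<alpha>) ^ p / fact p * (exp (t * b) * vnorm u0))"
    using arnoldi_exp_error[OF _ v0 v0_nz assms(6) _ _ ar, of \<alpha> b t] assms(5)
    by (simp add: err_def w_def norm_v0 b_def)
  have "Q \<in> carrier_mat (m * n) p" using ar v0 by (simp add: arnoldi_result_def)
  then have w: "w \<in> carrier_vec (m * n)"
    by (intro carrier_vecI) (simp add: w_def)
  have err: "err \<in> carrier_vec (m * n)" using carrier_vecD[OF w] by (intro carrier_vecI) (simp add: err_def)
  have diff: "coeffs n N A u0 t l $ i - w $ (l * n + i) = block n err l $ i" if "l < k" "i < n" for l i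
  proof -
    have l: "l < m" using that assms(8) by simp
    show ?thesis
      using mexpv_Lmat_index[OF assms(3) l that(2)] block_index_less[OF l that(2)] w that
      by (simp add: coeffs_eq_exp_coeff[OF assms(3)] block_def err_def v0_def)
  qed
  have "vnorm (vec n (\<lambda>i. \<Sum>l<k. \<epsilon>^l * (coeffs n N A u0 t l $ i - vec n (\<lambda>i. w $ (l*n + i)) $ i)))
      = vnorm (vec n (\<lambda>i. \<Sum>l<k. \<epsilon>^l * block n err l $ i))"
    by (intro arg_cong[where f = vnorm] eq_vecI) (auto simp: diff)
  also have "\<dots> \<le> (\<Sum>l<k. vnorm (vec n (\<lambda>i. \<epsilon>^l * block n err l $ i)))"
    by (rule vnorm_sum_le) simp
  also have "\<dots> = (\<Sum>l<k. \<bar>cmod \<epsilon> ^ l\<bar> * \<bar>vnorm (block n err l)\<bar>)"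
  proof (rule sum.cong[OF refl])
    fix l
    have "vec n (\<lambda>i. \<epsilon>^l * block n err l $ i) = \<epsilon> ^ l \<cdot>\<^sub>v block n err l"
      by (intro eq_vecI) (auto simp: block_def)
    then show "vnorm (vec n (\<lambda>i. \<epsilon>^l * block n err l $ i)) = \<bar>cmod \<epsilon> ^ l\<bar> * \<bar>vnorm (block n err l)\<bar>"
      by (simp add: vnorm_smult norm_power)
  qed
  also have "\<dots> \<le> L2_set (\<lambda>l. cmod \<epsilon> ^ l) {..<k} * L2_set (\<lambda>l. vnorm (block n err l)) {..<k}"
    by (rule L2_set_mult_ineq)
  \<comment> \<open>Since k \<le> m, the first \<open>k\<close> blocks are part of the whole error
    vector.\<close>
  also have "\<dots> \<le> L2_set (\<lambda>l. cmod \<epsilon> ^ l) {..<k} * vnorm err"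
    unfolding vnorm_eq_L2_set_blocks[OF err] using assms(8)
    by (intro mult_left_mono) (auto simp: L2_set_def intro!: sum_mono2 sum_nonneg)
  \<comment> \<open>A geometric sum with ratio |\<epsilon>|^2, where |\<epsilon>| \<noteq> 1 keeps
    the denominator nonzero. For |\<epsilon>| > 1 numerator and denominator are both
    negative.\<close>
  also have geometric: "L2_set (\<lambda>l. cmod \<epsilon> ^ l) {..<k} = sqrt ((1 - cmod \<epsilon> ^ (2*k)) / (1 - cmod \<epsilon> ^ 2))"
  proof -
    have "(cmod \<epsilon>)\<^sup>2 \<noteq> 1" using assms(10) by (simp add: abs_square_eq_1)
    then have "(\<Sum>l<k. ((cmod \<epsilon>)\<^sup>2) ^ l) = (1 - ((cmod \<epsilon>)\<^sup>2) ^ k) / (1 - (cmod \<epsilon>)\<^sup>2)"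
      by (simp add: sum_gp_strict)
    moreover have "(cmod \<epsilon> ^ l)\<^sup>2 = ((cmod \<epsilon>)\<^sup>2) ^ l" for l
      by (simp add: mult.commute flip: power_mult)
    ultimately show ?thesis by (simp add: L2_set_def power_mult)
  qed
  also have "sqrt ((1 - cmod \<epsilon> ^ (2*k)) / (1 - cmod \<epsilon> ^ 2)) * vnorm err
      \<le> sqrt ((1 - cmod \<epsilon> ^ (2*k)) / (1 - cmod \<epsilon> ^ 2)) * (2 * ((t * \<alpha>) ^ p / fact p * (exp (t * b) * vnorm u0)))"
    \<comment> \<open>Nonnegativity of the square root factor comes from its form as an
      \<open>L2_set\<close>, which saves a case distinction on |\<epsilon>|.\<close>
    using L2_set_nonneg[of "\<lambda>l. cmod \<epsilon> ^ l" "{..<k}"] unfolding geometric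
    by (rule mult_left_mono[OF err_le])
  finally show ?thesis
    by (simp add: Let_def w_def \<alpha>_def \<beta>_def b_def mult_ac)
qed

end
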